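(* Let $D\ge 1$, $\lambda>0$, $\phi\in(0,\pi/2]$, put $c_1=\frac{\lambda^{-1}}{4}\sin^2\phi$ and $c_2=\lambda^{-1}c_1(1-\cos\phi)$, and let $\Phi\in C^2(\mathbb{R}^D)$ satisfy: (H1) $\Phi(q)\ge 0$ for all $q$ and $\int_{\mathbb{R}^D}|q|^2e^{-\Phi(q)}\,dq<\infty$; (H2) there exist $a>0$ and $b\in(0,1)$ such that $$\tfrac12\langle\nabla\Phi(q),q\rangle\ \ge\ b\,\Phi(q)+\frac{(c_1b)^2+c_2b(1-b)}{2(1-b)}|q|^2-a\qquad\text{for all } q\in\mathbb{R}^D.$$ Let $Z$ be the RHMC process and $L$ its generator. Then for all globally Lipschitz and continuously differentiable functions $f:\mathbb{R}^{2D}\to\mathbb{R}$, for any initial condition $Z_0=z\in\mathbb{R}^{2D}$, and for any $t>0$, the local martingale $$M^f_t=f(Z_t)-f(z)-\int_0^tLf(Z_s)\,ds$$ is a martingale.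
   Context: Let $H(q,p)=\frac{|p|^2}{2}+\Phi(q)$ on $\mathbb{R}^{2D}$, and let $\theta_t:\mathbb{R}^{2D}\to\mathbb{R}^{2D}$ be the flow of Hamilton's equations $\dot q=p$, $\dot p=-\nabla\Phi(q)$ (globally defined since $\Phi\ge 0$). Momentum randomization: $\Gamma(q,p)=(q,\cos(\phi)p+\sin(\phi)\xi)$ with $\xi\sim\mathcal N(0,1)^D$ a standard $D$-dimensional Gaussian vector. RHMC process $Z_t=(Q_t,P_t)$ with mean duration $\lambda$ and angle $\phi$, started at $Z_0=z$: the càdlàg Markov process with jump times $t_0=0$, $t_{n+1}=t_n+\delta t_n$, where $\delta t_n$ are i.i.d. exponential with mean $\lambda$; for $t_n\le s<t_{n+1}$, $Z_s=\theta_{s-t_n}(Z_{t_n})$, and $Z_{t_{n+1}}=\Gamma(\theta_{\delta t_n}(Z_{t_n}))$, a fresh independent Gaussian vector $\xi$ being used at each jump, all the $\delta t_n$ and Gaussian vectors being mutually independent. Generator: $Lf(q,p)=\lambda^{-1}\mathbb{E}\{f(\Gamma(q,p))-f(q,p)\}+p^T\nabla_qf(q,p)-\nabla\Phi(q)^T\nabla_pf(q,p)$, the expectation being over $\xi$. (Local) martingales are with respect to the natural filtration of $Z$. *)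

theory Defs
  imports "HOL-Probability.Probability"
begin

text \<open>Phase space points are pairs \<open>(q, p)\<close>; the product norm is the Euclidean norm
  \<open>sqrt (norm q ^ 2 + norm p ^ 2)\<close>.\<close>

type_synonym 'd phase = "(real ^ 'd) \<times> (real ^ 'd)"

definition grad :: "('a::real_inner \<Rightarrow> real) \<Rightarrow> 'a \<Rightarrow> 'a" where
  "grad f x = (THE D. GDERIV f x :> D)"

definition C1 :: "('a::real_normed_vector \<Rightarrow> 'b::real_normed_vector) \<Rightarrow> bool" where
  "C1 f \<longleftrightarrow> (\<exists>f' :: 'a \<Rightarrow> 'a \<Rightarrow>\<^sub>L 'b.
     (\<forall>x. (f has_derivative blinfun_apply (f' x)) (at x)) \<and> continuous_on UNIV f')"

definition C2 :: "('a::real_normed_vector \<Rightarrow> 'b::real_normed_vector) \<Rightarrow> bool" where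
  "C2 f \<longleftrightarrow> (\<exists>f' :: 'a \<Rightarrow> 'a \<Rightarrow>\<^sub>L 'b.
     (\<forall>x. (f has_derivative blinfun_apply (f' x)) (at x)) \<and> C1 f')"

definition hamiltonian_flow ::
    "(real ^ 'd \<Rightarrow> real) \<Rightarrow> (real \<Rightarrow> 'd::finite phase \<Rightarrow> 'd phase) \<Rightarrow> bool" where
  "hamiltonian_flow \<Phi> \<theta> \<longleftrightarrow>
     (\<forall>z. \<theta> 0 z = z \<and>
       (\<forall>t. ((\<lambda>s. \<theta> s z) has_vector_derivative
               (snd (\<theta> t z), - grad \<Phi> (fst (\<theta> t z)))) (at t)))"

definition std_gaussian :: "(real ^ 'd::finite) measure" where
  "std_gaussian =
     distr (PiM UNIV (\<lambda>_. density lborel std_normal_density)) borel (\<lambda>x. \<chi> i. x i)"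

definition momentum_refresh ::
    "real \<Rightarrow> 'd::finite phase \<Rightarrow> real ^ 'd \<Rightarrow> 'd phase" where
  "momentum_refresh \<phi> z x = (fst z, cos \<phi> *\<^sub>R snd z + sin \<phi> *\<^sub>R x)"

text \<open>The skeleton is the state right after the \<open>n\<close>-th jump, as a function of the
  realised waiting times \<open>d\<close> and Gaussian vectors \<open>x\<close>.\<close>

primrec skeleton ::
    "real \<Rightarrow> (real \<Rightarrow> 'd phase \<Rightarrow> 'd phase) \<Rightarrow> 'd::finite phase \<Rightarrow>
     (nat \<Rightarrow> real) \<Rightarrow> (nat \<Rightarrow> real ^ 'd) \<Rightarrow> nat \<Rightarrow> 'd phase" where
  "skeleton \<phi> \<theta> z d x 0 = z"
| "skeleton \<phi> \<theta> z d x (Suc n) =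
     momentum_refresh \<phi> (\<theta> (d n) (skeleton \<phi> \<theta> z d x n)) (x n)"

definition jump_time :: "(nat \<Rightarrow> real) \<Rightarrow> nat \<Rightarrow> real" where
  "jump_time d n = (\<Sum>k<n. d k)"

definition cadlag :: "(real \<Rightarrow> 'a::topological_space) \<Rightarrow> bool" where
  "cadlag x \<longleftrightarrow>
     (\<forall>t\<ge>0. (x \<longlongrightarrow> x t) (at_right t)) \<and> (\<forall>t>0. \<exists>l. (x \<longlongrightarrow> l) (at_left t))"

text \<open>The waiting times and Gaussian vectors have different types, so their mutual independence
  is stated for the family of generated \<open>\<sigma>\<close>-algebras indexed by \<^typ>\<open>nat + nat\<close>. The
  piecewise formula determines the whole path only where all waiting times are positive and the
  jump times diverge, which is almost surely the case; on the exceptional null set nothing but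
  \<open>cadlag\<close> paths is required.\<close>

locale rhmc_process = prob_space M
  for M :: "'w measure"
  and lam \<phi> :: real
  and \<theta> :: "real \<Rightarrow> 'd::finite phase \<Rightarrow> 'd phase"
  and z :: "'d phase"
  and \<delta> :: "nat \<Rightarrow> 'w \<Rightarrow> real"
  and \<xi> :: "nat \<Rightarrow> 'w \<Rightarrow> real ^ 'd"
  and Z :: "real \<Rightarrow> 'w \<Rightarrow> 'd phase" +
  assumes waiting_times: "\<And>n. distributed M lborel (\<delta> n) (exponential_density (1 / lam))"
    and gaussians_measurable: "\<And>n. \<xi> n \<in> borel_measurable M"
    and gaussians: "\<And>n. distr M borel (\<xi> n) = std_gaussian"
    and independence:
      "indep_sets
         (case_sum (\<lambda>n. {\<delta> n -` A \<inter> space M | A. A \<in> sets borel})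
                   (\<lambda>n. {\<xi> n -` A \<inter> space M | A. A \<in> sets borel})) UNIV"
    and Z_measurable: "\<And>s. 0 \<le> s \<Longrightarrow> Z s \<in> borel_measurable M"
    and Z_cadlag: "\<And>\<omega>. \<omega> \<in> space M \<Longrightarrow> cadlag (\<lambda>s. Z s \<omega>)"
    and Z_path:
      "AE \<omega> in M. \<forall>n s.
         jump_time (\<lambda>k. \<delta> k \<omega>) n \<le> s \<and> s < jump_time (\<lambda>k. \<delta> k \<omega>) (Suc n) \<longrightarrow>
         Z s \<omega> = \<theta> (s - jump_time (\<lambda>k. \<delta> k \<omega>) n)
                    (skeleton \<phi> \<theta> z (\<lambda>k. \<delta> k \<omega>) (\<lambda>k. \<xi> k \<omega>) n)"

definition rhmc_generator ::
    "real \<Rightarrow> real \<Rightarrow> (real ^ 'd \<Rightarrow> real) \<Rightarrow> ('d::finite phase \<Rightarrow> real) \<Rightarrow> 'd phase \<Rightarrow> real" where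
  "rhmc_generator lam \<phi> \<Phi> f = (\<lambda>(q, p).
     1 / lam * (\<integral>x. f (momentum_refresh \<phi> (q, p) x) - f (q, p) \<partial>std_gaussian)
     + p \<bullet> grad (\<lambda>q'. f (q', p)) q - grad \<Phi> q \<bullet> grad (\<lambda>p'. f (q, p')) p)"

definition natural_filtration ::
    "'w measure \<Rightarrow> (real \<Rightarrow> 'w \<Rightarrow> 'a::topological_space) \<Rightarrow> real \<Rightarrow> 'w measure" where
  "natural_filtration M X t =
     sigma (space M) {X s -` A \<inter> space M | s A. 0 \<le> s \<and> s \<le> t \<and> A \<in> sets borel}"

text \<open>Only the time indices \<open>t \<ge> 0\<close> of the process \<open>X\<close> matter.\<close>

definition martingale ::
    "'w measure \<Rightarrow> (real \<Rightarrow> 'w measure) \<Rightarrow> (real \<Rightarrow> 'w \<Rightarrow> real) \<Rightarrow> bool" where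
  "martingale M F X \<longleftrightarrow>
     filtration (space M) F \<and> (\<forall>t. subalgebra M (F t)) \<and>
     (\<forall>t\<ge>0. X t \<in> borel_measurable (F t) \<and> integrable M (X t)) \<and>
     (\<forall>s t. 0 \<le> s \<and> s \<le> t \<longrightarrow> (AE \<omega> in M. real_cond_exp M (F s) (X t) \<omega> = X s \<omega>))"

end

theory Submission
  imports Defs
begin

text \<open>
  Why \<open>M\<^sup>f\<close> is a true martingale. Between two jumps the path follows the Hamiltonian flow, and the
  transport part \<open>p \<bullet> \<nabla>\<^sub>q f - \<nabla>\<Phi> \<bullet> \<nabla>\<^sub>p f\<close> of the generator is the time derivative of \<open>f\<close> along that
  flow. Its integral therefore telescopes against the increments of \<open>f\<close> along the flow segments, and
  \<open>M\<^sup>f\<close> becomes a sum of compensated jumps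
  \<open>M\<^sup>f\<^sub>t = \<Sum>\<^sub>n J\<^sub>n(t) - \<lambda>\<^bsup>-1\<^esup> I\<^sub>n(t)\<close>, where \<open>J\<^sub>n(t)\<close> is the jump of \<open>f\<close> at \<open>T\<^bsub>n+1\<^esub>\<close> if that time is at
  most \<open>t\<close> (and 0 otherwise) and \<open>I\<^sub>n(t)\<close> is the integral of the mean jump \<open>\<E>[f(\<Gamma> Z\<^sub>s) - f(Z\<^sub>s)]\<close> over the part
  of \<open>[T\<^sub>n, T\<^bsub>n+1\<^esub>)\<close> before \<open>t\<close>
  (lemma \<open>M_f_eq_sum_jump_terms\<close>). The possibly huge gradient of \<open>\<Phi>\<close> has disappeared from this
  expression; what is left is controlled by the Lipschitz constant of \<open>f\<close> and by momenta.

  Momenta are controlled by the energy radius \<open>sqrt (2 \<Phi>(q) + |p|\<^sup>2)\<close>, which dominates \<open>|p|\<close>, is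
  constant along the flow, and grows at a jump by at most the length of the fresh Gaussian vector, because it is the norm of
  \<open>(sqrt (2 \<Phi>(q)), p)\<close>. Hence the \<open>n\<close>-th compensated jump (counted from 0) is at most a constant times
  \<open>1\<^bsub>T\<^sub>n \<le> t\<^esub> (1 + |\<xi>\<^sub>0| + \<dots> + |\<xi>\<^sub>n|)\<close>. Bounding the indicator by \<open>exp (t - T\<^sub>n)\<close> and using independence,
  its expectation decays geometrically up to a linear factor, so the series converges in \<open>L\<^sup>1\<close>
  (lemma \<open>summable_expectation_jump_term\<close>).

  Conditionally on the first \<open>n\<close> waiting times and Gaussian vectors, a compensated jump has mean zero:
  this is Fubini together with the identity between the density of an exponential law and \<open>1 / \<lambda>\<close> times
  its tail (lemmas \<open>exponential_compensator\<close>, \<open>compensated_jump_mean_zero\<close>,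
  \<open>jump_term_orthogonal_to_past\<close>). To reach the natural filtration, let \<open>A\<close> be an event of the
  history of \<open>Z\<close> up to \<open>s\<close>. On \<open>s < T\<^bsub>n+1\<^esub>\<close> it coincides with an event of the first \<open>n\<close> noises,
  since there the path up to \<open>s\<close> is a function of them; off that set the \<open>n\<close>-th
  compensated jump has the same value at \<open>s\<close> and at every later time. So every single
  term satisfies the martingale identity on \<open>A\<close>, and \<open>L\<^sup>1\<close> convergence transfers it to the sum.
\<close>

section \<open>Gradients of continuously differentiable functions\<close>

lemma has_derivative_imp_grad:
  fixes f :: "'a::euclidean_space \<Rightarrow> real"
  assumes "(f has_derivative f') (at x)"
  shows "grad f x = (\<Sum>b\<in>Basis. f' b *\<^sub>R b)" and "f' h = h \<bullet> grad f x"
proof -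
  define g where "g = (\<Sum>b\<in>Basis. f' b *\<^sub>R b)"
  have lin: "linear f'" using assms has_derivative_linear by blast
  have f': "f' h = h \<bullet> g" for h
  proof -
    have "f' h = f' (\<Sum>b\<in>Basis. (h \<bullet> b) *\<^sub>R b)" by (simp add: euclidean_representation)
    also have "\<dots> = (\<Sum>b\<in>Basis. (h \<bullet> b) * f' b)"
      by (simp add: linear_sum[OF lin] linear_scale[OF lin])
    finally show ?thesis by (simp add: g_def inner_sum_right mult.commute)
  qed
  have "f' = (\<lambda>h. h \<bullet> g)" by (rule ext) (rule f')
  with assms have g: "GDERIV f x :> g" by (simp add: gderiv_def)
  moreover have "D = g" if "GDERIV f x :> D" for D
  proof -
    have "(\<lambda>h. h \<bullet> D) = (\<lambda>h. h \<bullet> g)"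
      using that g has_derivative_unique unfolding gderiv_def by blast
    then have "\<forall>h. h \<bullet> D = h \<bullet> g" by (simp add: fun_eq_iff)
    then show ?thesis by (rule vector_eq_ldot[THEN iffD1])
  qed
  ultimately have "grad f x = g" unfolding grad_def by (rule the_equality)
  then show "grad f x = (\<Sum>b\<in>Basis. f' b *\<^sub>R b)" "f' h = h \<bullet> grad f x"
    by (simp only: g_def, simp only: f')
qed

lemma C1_has_derivative_grad:
  fixes f :: "'a::euclidean_space \<Rightarrow> real"
  assumes "C1 f"
  shows "(f has_derivative (\<lambda>h. h \<bullet> grad f x)) (at x)"
proof -
  from assms[unfolded C1_def] obtain f' where
      "\<forall>x. (f has_derivative blinfun_apply (f' x)) (at x)"
    by (elim exE conjE)
  then have *: "(f has_derivative blinfun_apply (f' x)) (at x)" by simp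
  have "blinfun_apply (f' x) = (\<lambda>h. h \<bullet> grad f x)"
    by (rule ext) (rule has_derivative_imp_grad(2)[OF *])
  with * show ?thesis by simp
qed

lemma C1_imp_continuous_grad:
  fixes f :: "'a::euclidean_space \<Rightarrow> real"
  assumes "C1 f"
  shows "continuous_on UNIV (grad f)"
proof -
  from assms[unfolded C1_def] obtain f' where
      "\<forall>x. (f has_derivative blinfun_apply (f' x)) (at x)" "continuous_on UNIV f'"
    by (elim exE conjE)
  then have f': "(f has_derivative blinfun_apply (f' x)) (at x)" "continuous_on UNIV f'" for x
    by simp_all
  have "grad f = (\<lambda>x. \<Sum>b\<in>Basis. f' x b *\<^sub>R b)"
      by (rule ext) (rule has_derivative_imp_grad(1)[OF f'(1)])
  then show ?thesis
    by (simp only:) (intro continuous_on_sum continuous_on_scaleR blinfun.continuous_on continuous_on_const f'(2))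
qed

lemma C1_imp_continuous:
  assumes "C1 f"
  shows "continuous_on A f"
proof -
  from assms[unfolded C1_def] obtain f' where
      "\<forall>x. (f has_derivative blinfun_apply (f' x)) (at x)"
    by (elim exE conjE)
  then have "(f has_derivative blinfun_apply (f' x)) (at x)" for x by simp
  from has_derivative_continuous[OF this] show ?thesis
    by (intro continuous_at_imp_continuous_on ballI)
qed

lemma C2_imp_C1:
  assumes "C2 f"
  shows "C1 f"
proof -
  from assms[unfolded C2_def] obtain f' where
      f': "\<forall>x. (f has_derivative blinfun_apply (f' x)) (at x)" "C1 f'"
    by (elim exE conjE)
  show ?thesis
    unfolding C1_def by (intro exI[of _ f'] conjI f' C1_imp_continuous)
qed

lemma C2_imp_grad_lipschitz_on_cball:
  fixes f :: "'a::euclidean_space \<Rightarrow> real"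
  assumes "C2 f"
  obtains L where "L \<ge> 0"
    "\<And>x y. x \<in> cball 0 \<rho> \<Longrightarrow> y \<in> cball 0 \<rho> \<Longrightarrow> norm (grad f x - grad f y) \<le> L * norm (x - y)"
proof -
  from assms[unfolded C2_def] obtain f' where
      f'0: "\<forall>x. (f has_derivative blinfun_apply (f' x)) (at x)" "C1 f'"
    by (elim exE conjE)
  from f'0(2)[unfolded C1_def] obtain f'' where
      f''0: "\<forall>x. (f' has_derivative blinfun_apply (f'' x)) (at x)" "continuous_on UNIV f''"
    by (elim exE conjE)
  have f': "(f has_derivative blinfun_apply (f' x)) (at x)"
    and f'': "(f' has_derivative blinfun_apply (f'' x)) (at x)" "continuous_on UNIV f''" for x
    using f'0 f''0 by simp_all
  have "compact (f'' ` cball 0 \<rho>)"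
    by (intro compact_continuous_image continuous_on_subset[OF f''(2)]) auto
  then obtain L where L: "L > 0" "\<And>x. x \<in> cball 0 \<rho> \<Longrightarrow> norm (f'' x) \<le> L"
    using compact_imp_bounded[of "f'' ` cball 0 \<rho>"] unfolding bounded_pos by auto
  have lip: "norm (f' x - f' y) \<le> L * norm (x - y)" if "x \<in> cball 0 \<rho>" "y \<in> cball 0 \<rho>" for x y
  proof (rule differentiable_bound[OF convex_cball _ _ that])
    show "(f' has_derivative blinfun_apply (f'' y)) (at y within cball 0 \<rho>)" for y
      by (rule has_derivative_at_withinI[OF f''(1)])
    show "onorm (blinfun_apply (f'' y)) \<le> L" if "y \<in> cball 0 \<rho>" for y
      using L(2)[OF that] by (simp only: norm_blinfun.rep_eq)
  qed
  have "norm (grad f x - grad f y) \<le> L * norm (x - y)"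
    if "x \<in> cball 0 \<rho>" "y \<in> cball 0 \<rho>" for x y
  proof -
    let ?v = "grad f x - grad f y"
    have "norm ?v * norm ?v = ?v \<bullet> ?v" by (simp add: dot_square_norm power2_eq_square)
    also have "\<dots> = (f' x - f' y) ?v"
      by (simp add: has_derivative_imp_grad(2)[OF f'] blinfun.diff_left inner_diff_right)
    also have "\<dots> \<le> norm (f' x - f' y) * norm ?v"
      by (rule order_trans[OF abs_ge_self]) (rule norm_blinfun[of "f' x - f' y" ?v, unfolded real_norm_def])
    finally have "norm ?v \<le> norm (f' x - f' y)"
      by (metis mult_right_le_imp_le norm_ge_zero order_le_less)
    then show ?thesis using lip[OF that] by linarith
  qed
  then show ?thesis by (rule that[OF less_imp_le[OF L(1)]])
qed

section \<open>Energy and continuity of the Hamiltonian flow\<close>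

text \<open>The hypothesis bounds \<open>|u'|\<close>, so \<open>u\<close> can neither grow faster than \<open>exp (K s)\<close> forwards nor
  backwards in time. Both directions are needed because the flow is indexed by all real times.\<close>

lemma gronwall_two_sided:
  fixes u u' :: "real \<Rightarrow> real"
  assumes deriv: "\<And>s. (u has_real_derivative u' s) (at s)"
    and bound: "\<And>s. \<bar>s\<bar> \<le> \<bar>t\<bar> \<Longrightarrow> \<bar>u' s\<bar> \<le> K * u s"
  shows "u t \<le> u 0 * exp (K * \<bar>t\<bar>)"
proof (cases "t \<ge> 0")
  case True
  have "u t * exp (- K * t) \<le> u 0 * exp (- K * 0)"
  proof (rule DERIV_nonpos_imp_nonincreasing[OF True])
    fix s assume s: "0 \<le> s" "s \<le> t"
    have "((\<lambda>s. u s * exp (- K * s)) has_real_derivative (u' s - K * u s) * exp (- K * s)) (at s)"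
      by (rule derivative_eq_intros deriv refl | simp add: algebra_simps)+
    moreover have "(u' s - K * u s) * exp (- K * s) \<le> 0"
      using bound[of s] s by (intro mult_nonpos_nonneg) auto
    ultimately show "\<exists>y. ((\<lambda>s. u s * exp (- K * s)) has_real_derivative y) (at s) \<and> y \<le> 0"
      by blast
  qed
  then have "u t * exp (- K * t) * exp (K * t) \<le> u 0 * exp (K * t)" by simp
  then show ?thesis using True by (simp add: mult.assoc flip: exp_add)
next
  case False
  then have t: "t \<le> 0" by simp
  have "u t * exp (K * t) \<le> u 0 * exp (K * 0)"
  proof (rule DERIV_nonneg_imp_nondecreasing[OF t])
    fix s assume s: "t \<le> s" "s \<le> 0"
    have "((\<lambda>s. u s * exp (K * s)) has_real_derivative (u' s + K * u s) * exp (K * s)) (at s)"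
      by (rule derivative_eq_intros deriv refl | simp add: algebra_simps)+
    moreover have "(u' s + K * u s) * exp (K * s) \<ge> 0"
      using bound[of s] s by (intro mult_nonneg_nonneg) auto
    ultimately show "\<exists>y. ((\<lambda>s. u s * exp (K * s)) has_real_derivative y) (at s) \<and> 0 \<le> y"
      by blast
  qed
  then have "u t * exp (K * t) * exp (- K * t) \<le> u 0 * exp (- K * t)" by simp
  then show ?thesis using t by (simp add: mult.assoc flip: exp_add)
qed

text \<open>The radius of the energy sphere: \<open>sqrt (2 H)\<close> for the Hamiltonian \<open>H(q, p) = |p|\<^sup>2 / 2 + \<Phi>(q)\<close>. The
  square root makes it a norm in \<open>(sqrt (2 \<Phi>(q)), p)\<close>, hence subadditive
  under the addition of noise to \<open>p\<close>.\<close>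

definition energy_radius :: "(real ^ 'd \<Rightarrow> real) \<Rightarrow> 'd::finite phase \<Rightarrow> real" where
  "energy_radius \<Phi> z = sqrt (2 * \<Phi> (fst z) + (norm (snd z))\<^sup>2)"

locale hamiltonian_dynamics =
  fixes \<Phi> :: "real ^ 'd::finite \<Rightarrow> real" and \<theta> :: "real \<Rightarrow> 'd phase \<Rightarrow> 'd phase"
  assumes potential_C2: "C2 \<Phi>"
    and potential_nonneg: "\<Phi> q \<ge> 0"
    and flow: "hamiltonian_flow \<Phi> \<theta>"
begin

abbreviation vector_field :: "'d phase \<Rightarrow> 'd phase" where
  "vector_field z \<equiv> (snd z, - grad \<Phi> (fst z))"

lemma flow_zero [simp]: "\<theta> 0 z = z"
  using flow unfolding hamiltonian_flow_def by blast

lemma flow_has_vector_derivative: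
  "((\<lambda>s. \<theta> s z) has_vector_derivative vector_field (\<theta> t z)) (at t)"
  using flow unfolding hamiltonian_flow_def by blast

lemma flow_fst_has_vector_derivative:
    "((\<lambda>s. fst (\<theta> s z)) has_vector_derivative snd (\<theta> t z)) (at t)"
  and flow_snd_has_vector_derivative:
    "((\<lambda>s. snd (\<theta> s z)) has_vector_derivative - grad \<Phi> (fst (\<theta> t z))) (at t)"
  using bounded_linear.has_vector_derivative[OF bounded_linear_fst flow_has_vector_derivative[of z t]]
    bounded_linear.has_vector_derivative[OF bounded_linear_snd flow_has_vector_derivative[of z t]]
  by simp_all

lemma flow_continuous_time: "continuous_on A (\<lambda>s. \<theta> s z)"
  using flow_has_vector_derivative has_vector_derivative_continuous
  by (blast intro: continuous_at_imp_continuous_on)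

lemma potential_continuous: "continuous_on A \<Phi>"
  by (intro C1_imp_continuous C2_imp_C1 potential_C2)

lemma grad_potential_continuous: "continuous_on A (grad \<Phi>)"
  using C1_imp_continuous_grad[OF C2_imp_C1[OF potential_C2]] continuous_on_subset by blast

lemma energy_radius_continuous: "continuous_on A (energy_radius \<Phi>)"
  unfolding energy_radius_def
  by (intro continuous_intros continuous_on_compose2[OF potential_continuous[of UNIV]]) auto

text \<open>Conservation of energy: the two contributions \<open>\<nabla>\<Phi> \<bullet> p\<close> to the derivative of \<open>2 H\<close> cancel.\<close>

lemma energy_radius_flow: "energy_radius \<Phi> (\<theta> t z) = energy_radius \<Phi> z"
proof -
  have 1: "((\<lambda>s. \<Phi> (fst (\<theta> s z))) has_real_derivative
     snd (\<theta> s z) \<bullet> grad \<Phi> (fst (\<theta> s z))) (at s)" for s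
    using vector_derivative_diff_chain_within[of "\<lambda>s. fst (\<theta> s z)" _ s UNIV \<Phi>,
        OF flow_fst_has_vector_derivative
        has_derivative_at_withinI[OF C1_has_derivative_grad[OF C2_imp_C1[OF potential_C2]]]]
    by (simp add: o_def has_real_derivative_iff_has_vector_derivative)
  have 2: "((\<lambda>s. snd (\<theta> s z) \<bullet> snd (\<theta> s z)) has_real_derivative
     - 2 * (snd (\<theta> s z) \<bullet> grad \<Phi> (fst (\<theta> s z)))) (at s)" for s
    using bounded_bilinear.has_vector_derivative[OF bounded_bilinear_inner
        flow_snd_has_vector_derivative[of z s] flow_snd_has_vector_derivative[of z s]]
    by (simp add: has_real_derivative_iff_has_vector_derivative inner_commute)
  have "((\<lambda>s. 2 * \<Phi> (fst (\<theta> s z)) + snd (\<theta> s z) \<bullet> snd (\<theta> s z)) has_real_derivative 0) (at s)" for s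
    by (rule derivative_eq_intros 1 2 refl | simp)+
  then have "2 * \<Phi> (fst (\<theta> t z)) + snd (\<theta> t z) \<bullet> snd (\<theta> t z)
      = 2 * \<Phi> (fst (\<theta> 0 z)) + snd (\<theta> 0 z) \<bullet> snd (\<theta> 0 z)"
    by (rule DERIV_isconst_all[OF allI])
  then show ?thesis by (simp add: energy_radius_def dot_square_norm)
qed

lemma norm_momentum_le_energy_radius: "norm (snd z) \<le> energy_radius \<Phi> z"
  unfolding energy_radius_def using potential_nonneg[of "fst z"] by (intro real_le_rsqrt) auto

lemma energy_radius_nonneg: "0 \<le> energy_radius \<Phi> z"
  using norm_momentum_le_energy_radius[of z] norm_ge_zero order_trans by blast

lemma norm_momentum_flow_le: "norm (snd (\<theta> t z)) \<le> energy_radius \<Phi> z"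
  using norm_momentum_le_energy_radius[of "\<theta> t z"] by (simp add: energy_radius_flow)

text \<open>The conserved energy bounds the velocity, so positions move at most linearly in time. This
  confines flow lines over bounded times to a ball on which \<open>\<nabla>\<Phi>\<close> is Lipschitz.\<close>

lemma norm_position_flow_le:
  "norm (fst (\<theta> t z)) \<le> norm (fst z) + \<bar>t\<bar> * energy_radius \<Phi> z"
proof -
  have "norm (fst (\<theta> t z) - fst (\<theta> 0 z)) \<le> energy_radius \<Phi> z * norm (t - 0)"
  proof (rule differentiable_bound[of UNIV])
    show "((\<lambda>s. fst (\<theta> s z)) has_derivative (\<lambda>h. h *\<^sub>R snd (\<theta> s z))) (at s within UNIV)" for s
      using flow_fst_has_vector_derivative by (simp add: has_vector_derivative_def)
    show "onorm (\<lambda>h. h *\<^sub>R snd (\<theta> s z)) \<le> energy_radius \<Phi> z" for s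
      by (rule onorm_le) (simp add: mult.commute norm_momentum_flow_le mult_left_mono)
  qed auto
  then show ?thesis
    using norm_triangle_sub[of "fst (\<theta> t z)" "fst z"] by (simp add: mult.commute)
qed

text \<open>Gronwall for the squared distance of two flow lines. Both stay in the ball of radius
  \<open>r + T * E\<close>, on which the vector field is Lipschitz with constant governed by \<open>L\<close>.\<close>

lemma flow_dependence_on_initial_value:
  assumes E: "energy_radius \<Phi> z \<le> E" "energy_radius \<Phi> z' \<le> E"
    and q: "norm (fst z) \<le> r" "norm (fst z') \<le> r"
    and L0: "L \<ge> 0"
    and L: "\<And>x y. x \<in> cball 0 (r + T * E) \<Longrightarrow> y \<in> cball 0 (r + T * E) \<Longrightarrow>
              norm (grad \<Phi> x - grad \<Phi> y) \<le> L * norm (x - y)"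
    and t: "\<bar>t\<bar> \<le> T"
  shows "(norm (\<theta> t z - \<theta> t z'))\<^sup>2 \<le> (norm (z - z'))\<^sup>2 * exp ((1 + L) * \<bar>t\<bar>)"
proof -
  define v where "v s = \<theta> s z - \<theta> s z'" for s
  define w where "w s = vector_field (\<theta> s z) - vector_field (\<theta> s z')" for s
  have v: "(v has_vector_derivative w s) (at s)" for s
    unfolding v_def w_def by (intro has_vector_derivative_diff flow_has_vector_derivative)
  have d: "((\<lambda>s. v s \<bullet> v s) has_real_derivative 2 * (v s \<bullet> w s)) (at s)" for s
    using bounded_bilinear.has_vector_derivative[OF bounded_bilinear_inner v v]
    by (simp add: has_real_derivative_iff_has_vector_derivative inner_commute)
  have "v t \<bullet> v t \<le> (v 0 \<bullet> v 0) * exp ((1 + L) * \<bar>t\<bar>)"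
  proof (rule gronwall_two_sided[OF d])
    fix s assume s: "\<bar>s\<bar> \<le> \<bar>t\<bar>"
    have ball: "fst (\<theta> s y) \<in> cball 0 (r + T * E)"
      if "energy_radius \<Phi> y \<le> E" "norm (fst y) \<le> r" for y
    proof -
      have "\<bar>s\<bar> * energy_radius \<Phi> y \<le> T * E"
        using s t that energy_radius_nonneg[of y] by (intro mult_mono) auto
      then show ?thesis using norm_position_flow_le[of s y] that by simp
    qed
    let ?a = "norm (fst (v s))" and ?b = "norm (snd (v s))"
    let ?g = "grad \<Phi> (fst (\<theta> s z)) - grad \<Phi> (fst (\<theta> s z'))"
    have g: "norm ?g \<le> L * ?a"
      using L[OF ball[OF E(1) q(1)] ball[OF E(2) q(2)]] by (simp add: v_def)
    have "2 * (v s \<bullet> w s) = 2 * (fst (v s) \<bullet> snd (v s)) - 2 * (snd (v s) \<bullet> ?g)"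
      by (simp add: v_def w_def inner_prod_def inner_diff_right algebra_simps)
    then have "\<bar>2 * (v s \<bullet> w s)\<bar> \<le> 2 * \<bar>fst (v s) \<bullet> snd (v s)\<bar> + 2 * \<bar>snd (v s) \<bullet> ?g\<bar>"
      by linarith
    also have "\<dots> \<le> 2 * (?a * ?b) + 2 * (?b * (L * ?a))"
      using Cauchy_Schwarz_ineq2[of "fst (v s)" "snd (v s)"] Cauchy_Schwarz_ineq2[of "snd (v s)" ?g]
        mult_left_mono[OF g, of ?b] by (intro add_mono mult_left_mono) auto
    also have "\<dots> = (1 + L) * (2 * ?a * ?b)" by (simp add: algebra_simps)
    also have "\<dots> \<le> (1 + L) * (?a\<^sup>2 + ?b\<^sup>2)"
      using L0 by (intro mult_left_mono sum_squares_bound) auto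
    also have "?a\<^sup>2 + ?b\<^sup>2 = v s \<bullet> v s" by (simp add: inner_prod_def dot_square_norm)
    finally show "\<bar>2 * (v s \<bullet> w s)\<bar> \<le> (1 + L) * (v s \<bullet> v s)" .
  qed
  then show ?thesis by (simp add: v_def dot_square_norm)
qed

text \<open>The flow is given only as a family of solution curves, so its dependence on the initial value
  must be derived. Joint continuity is what makes the post-jump states random variables.\<close>

lemma flow_jointly_continuous: "continuous_on UNIV (\<lambda>(t, z). \<theta> t z)"
proof -
  have "((\<lambda>(t', z'). \<theta> t' z') \<longlongrightarrow> \<theta> t z) (at (t, z))" for t z
  proof -
    define T where "T = \<bar>t\<bar> + 1"
    have "compact (energy_radius \<Phi> ` cball z 1)"
      by (intro compact_continuous_image energy_radius_continuous) auto
    then obtain E where E: "\<And>y. y \<in> cball z 1 \<Longrightarrow> energy_radius \<Phi> y \<le> E"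
      using compact_imp_bounded bounded_real by (metis abs_le_D1 imageI)
    obtain L where L: "L \<ge> 0" "\<And>x y. x \<in> cball 0 (norm (fst z) + 1 + T * E) \<Longrightarrow>
        y \<in> cball 0 (norm (fst z) + 1 + T * E) \<Longrightarrow> norm (grad \<Phi> x - grad \<Phi> y) \<le> L * norm (x - y)"
      using C2_imp_grad_lipschitz_on_cball[OF potential_C2] by blast
    have near: "norm (\<theta> t' z' - \<theta> t' z) \<le> norm (z' - z) * sqrt (exp ((1 + L) * T))"
      if "z' \<in> cball z 1" "\<bar>t'\<bar> \<le> T" for t' z'
    proof -
      have "norm (fst z' - fst z) \<le> norm (z' - z)"
        by (cases z, cases z') (simp add: norm_fst_le)
      with that have q: "norm (fst z') \<le> norm (fst z) + 1"
        using norm_triangle_sub[of "fst z'" "fst z"] by (simp add: dist_norm norm_minus_commute)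
      have "(norm (\<theta> t' z' - \<theta> t' z))\<^sup>2 \<le> (norm (z' - z))\<^sup>2 * exp ((1 + L) * \<bar>t'\<bar>)"
        using that q E by (intro flow_dependence_on_initial_value[where T = T and E = E, OF _ _ _ _ L]) auto
      also have "\<dots> \<le> (norm (z' - z))\<^sup>2 * exp ((1 + L) * T)"
        using that L(1) by (intro mult_left_mono) auto
      finally have "sqrt ((norm (\<theta> t' z' - \<theta> t' z))\<^sup>2) \<le> sqrt ((norm (z' - z))\<^sup>2 * exp ((1 + L) * T))"
        by (rule real_sqrt_le_mono)
      then show ?thesis by (simp add: real_sqrt_mult)
    qed
    have lim0: "((\<lambda>x. norm (snd x - z) * sqrt (exp ((1 + L) * T)) + norm (\<theta> (fst x) z - \<theta> t z))
        \<longlongrightarrow> 0) (at (t, z))"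
    proof -
      have "((\<lambda>s. \<theta> s z) \<longlongrightarrow> \<theta> t z) (at t)"
        using flow_continuous_time[of UNIV z] continuous_on_eq_continuous_at isCont_def by blast
      then have "isCont (\<lambda>x. \<theta> (fst x) z) (t, z)"
        by (intro isCont_o2[of _ fst "\<lambda>s. \<theta> s z"] isCont_fst) (simp_all add: isCont_def)
      then have "isCont (\<lambda>x. norm (snd x - z) * sqrt (exp ((1 + L) * T)) + norm (\<theta> (fst x) z - \<theta> t z)) (t, z)"
        by (intro continuous_intros)
      then show ?thesis by (simp add: isCont_def)
    qed
    have ev: "\<forall>\<^sub>F x in at (t, z). dist x (t, z) < 1"
      by (auto simp: eventually_at intro: exI[of _ 1])
    have "((\<lambda>x. (\<lambda>(t', z'). \<theta> t' z') x - \<theta> t z) \<longlongrightarrow> 0) (at (t, z))"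
    proof (rule Lim_null_comparison[OF _ lim0], rule eventually_mono[OF ev])
      fix x assume x: "dist x (t, z) < 1"
      obtain t' z' where [simp]: "x = (t', z')" by (cases x)
      have "dist t' t < 1" "dist z' z < 1"
        using x dist_fst_le[of x "(t, z)"] dist_snd_le[of x "(t, z)"] by auto
      then have "norm (\<theta> t' z' - \<theta> t' z) \<le> norm (z' - z) * sqrt (exp ((1 + L) * T))"
        by (intro near) (auto simp: T_def dist_commute dist_real_def)
      then show "norm ((\<lambda>(t', z'). \<theta> t' z') x - \<theta> t z)
          \<le> norm (snd x - z) * sqrt (exp ((1 + L) * T)) + norm (\<theta> (fst x) z - \<theta> t z)"
        using norm_triangle_ineq[of "\<theta> t' z' - \<theta> t' z" "\<theta> t' z - \<theta> t z"] by simp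
    qed
    then show ?thesis by (rule LIM_zero_cancel)
  qed
  then show ?thesis by (auto simp: continuous_on_def)
qed

lemma flow_measurable [measurable]: "(\<lambda>(t, z). \<theta> t z) \<in> borel \<Otimes>\<^sub>M borel \<rightarrow>\<^sub>M borel"
  using flow_jointly_continuous by (simp add: borel_prod borel_measurable_continuous_onI)

end

section \<open>Exponential waiting times and Gaussian momenta\<close>

lemma exponential_tail:
  assumes "l > 0" "r \<ge> 0"
  shows "measure (density lborel (exponential_density l)) {r<..} = exp (- l * r)"
proof -
  let ?E = "density lborel (exponential_density l)"
  interpret prob_space ?E by (rule prob_space_exponential_density[OF assms(1)])
  have "distributed ?E lborel (\<lambda>x. x) (exponential_density l)"
    unfolding distributed_def by (auto simp: distr_id2 intro!: exponential_density_nonneg assms)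
  from exponential_distributedD_gt[OF this assms(2,1)] show ?thesis
    by (simp add: greaterThan_def mult.commute)
qed

text \<open>The compensator formula for a single exponential clock \<open>d\<close> of rate \<open>l\<close>: charging \<open>w(r)\<close> at rate
  \<open>l\<close> while the clock has not rung costs on average as much as paying \<open>w(d)\<close> once, when it rings. By
  Fubini the left side is \<open>\<integral> l P(d > r) w(r) dr\<close>, and \<open>l P(d > r)\<close> is the exponential density.\<close>

lemma exponential_compensator:
  fixes w :: "real \<Rightarrow> real"
  assumes l: "l > 0" and [measurable]: "w \<in> borel_measurable borel"
    and int: "integrable lborel (\<lambda>r. indicator {0..} r * w r)"
  defines "E \<equiv> density lborel (exponential_density l)"
  shows "integrable E w"
    and "integrable E (\<lambda>d. \<integral>r. indicator {0..<d} r * w r \<partial>lborel)"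
    and "(\<integral>d. l * (\<integral>r. indicator {0..<d} r * w r \<partial>lborel) \<partial>E) = (\<integral>d. w d \<partial>E)"
proof -
  interpret E: prob_space E unfolding E_def by (rule prob_space_exponential_density[OF l])
  interpret pair_sigma_finite E "lborel :: real measure" ..
  have [measurable_cong]: "sets E = sets borel" by (simp add: E_def)
  have nonneg: "AE x in lborel. 0 \<le> exponential_density l x"
    using exponential_density_nonneg[OF l] by simp
  have density: "exponential_density l x *\<^sub>R w x = (l * exp (- l * x)) * (indicator {0..} x * w x)" for x
    by (auto simp: exponential_density_def indicator_def mult.commute)
  show "integrable E w"
    unfolding E_def
  proof (subst integrable_density[OF _ _ nonneg], simp, simp, unfold density,
      rule Bochner_Integration.integrable_bound[OF integrable_mult_right[OF int, of l]])
    show "AE x in lborel. norm (l * exp (- l * x) * (indicator {0..} x * w x))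
        \<le> norm (l * (indicator {0..} x * w x))"
      using l by (auto simp: abs_mult indicator_def mult_left_le_one_le intro!: mult_left_mono mult_right_mono)
  qed simp
  let ?F = "\<lambda>d r. indicator {0..<d} r * w r"
  have Fm [measurable]: "case_prod ?F \<in> borel_measurable (E \<Otimes>\<^sub>M lborel)"
    unfolding indicator_def atLeastLessThan_iff by measurable
  have F_le: "norm (?F d r) \<le> norm (indicator {0..} r * w r)" for d r
    by (auto simp: indicator_def)
  have F_int: "integrable lborel (?F d)" for d
    by (rule Bochner_Integration.integrable_bound[OF int]) (use F_le in auto)
  have "integrable (E \<Otimes>\<^sub>M lborel) (case_prod ?F)"
  proof (rule Fubini_integrable)
    show "integrable E (\<lambda>d. \<integral>r. norm (case_prod ?F (d, r)) \<partial>lborel)"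
    proof (rule E.integrable_const_bound[where B = "\<integral>r. norm (indicator {0..} r * w r) \<partial>lborel"])
      have "(\<integral>r. norm (?F d r) \<partial>lborel) \<le> (\<integral>r. norm (indicator {0..} r * w r) \<partial>lborel)" for d
        by (intro integral_mono integrable_norm F_int int F_le)
      then show "AE d in E. norm (\<integral>r. norm (case_prod ?F (d, r)) \<partial>lborel)
          \<le> (\<integral>r. norm (indicator {0..} r * w r) \<partial>lborel)"
        by (intro AE_I2) (simp add: integral_nonneg)
    qed measurable
  qed (use F_int in simp_all)
  from integrable_fst'[OF this] Fubini_integral[OF this]
  show "integrable E (\<lambda>d. \<integral>r. indicator {0..<d} r * w r \<partial>lborel)"
    and "(\<integral>d. l * (\<integral>r. indicator {0..<d} r * w r \<partial>lborel) \<partial>E) = (\<integral>d. w d \<partial>E)"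
  proof -
    assume 1: "integrable E (\<lambda>d. \<integral>r. case_prod ?F (d, r) \<partial>lborel)"
      and 2: "(\<integral>r. (\<integral>d. ?F d r \<partial>E) \<partial>lborel) = (\<integral>d. (\<integral>r. ?F d r \<partial>lborel) \<partial>E)"
    show "integrable E (\<lambda>d. \<integral>r. indicator {0..<d} r * w r \<partial>lborel)" using 1 by simp
    have inner: "(\<integral>d. ?F d r \<partial>E) = exp (- l * r) * (indicator {0..} r * w r)" for r
    proof (cases "r \<ge> 0")
      case True
      have "(\<integral>d. ?F d r \<partial>E) = (\<integral>d. indicator {r<..} d * w r \<partial>E)"
        using True by (intro Bochner_Integration.integral_cong) (auto simp: indicator_def)
      also have "\<dots> = measure E {r<..} * w r" by (simp add: E_def)
      finally show ?thesis using True exponential_tail[OF l True] by (simp add: E_def)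
    qed (auto simp: indicator_def)
    have "(\<integral>d. w d \<partial>E) = (\<integral>x. exponential_density l x *\<^sub>R w x \<partial>lborel)"
      unfolding E_def by (rule integral_density) (use nonneg in auto)
    also have "\<dots> = (\<integral>x. l * (\<integral>d. ?F d x \<partial>E) \<partial>lborel)"
      by (simp only: density inner mult.assoc)
    finally show "(\<integral>d. l * (\<integral>r. indicator {0..<d} r * w r \<partial>lborel) \<partial>E) = (\<integral>d. w d \<partial>E)"
      using 2 by simp
  qed
qed

lemma sets_std_gaussian [simp, measurable_cong]: "sets std_gaussian = sets borel"
  by (simp add: std_gaussian_def)

lemma space_std_gaussian [simp]: "space std_gaussian = UNIV"
  by (simp add: std_gaussian_def)

text \<open>The product measure carries the sets of \<open>PiM\<close>, not of the Borel space of vectors, so the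
  measurability of assembling coordinates into a vector is checked coordinatewise.\<close>

lemma vec_lambda_measurable [measurable]:
  "(\<lambda>x. \<chi> i. x i) \<in> borel_measurable (PiM (UNIV :: 'd::finite set) (\<lambda>_. density lborel std_normal_density))"
    (is "?v \<in> borel_measurable ?P")
proof (rule borel_measurable_euclidean_space[THEN iffD2], rule ballI)
  fix b :: "real ^ 'd" assume "b \<in> Basis"
  then obtain i where b: "b = axis i 1" by (auto simp: Basis_vec_def)
  have "(\<lambda>x. x i) \<in> ?P \<rightarrow>\<^sub>M density lborel std_normal_density"
    by (rule measurable_component_singleton) simp
  then show "(\<lambda>x. ?v x \<bullet> b) \<in> borel_measurable ?P" by (simp add: b inner_axis)
qed

lemma prob_space_std_gaussian: "prob_space (std_gaussian :: (real ^ 'd::finite) measure)"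
  unfolding std_gaussian_def
  by (intro prob_space.prob_space_distr prob_space_PiM prob_space_normal_density zero_less_one vec_lambda_measurable)

lemma integrable_norm_std_gaussian:
  "integrable (std_gaussian :: (real ^ 'd::finite) measure) norm"
proof -
  let ?N = "density lborel std_normal_density :: real measure"
  let ?P = "PiM (UNIV :: 'd set) (\<lambda>_. ?N)"
  have N: "integrable ?N abs"
    using integrable_std_normal_moment_abs[of 1]
    by (subst integrable_density) (auto intro: normal_density_nonneg)
  have "integrable ?P (\<lambda>x. \<bar>x i\<bar>)" for i :: 'd
  proof -
    have "integrable (distr ?P ?N (\<lambda>\<omega>. \<omega> i)) abs"
      using N by (subst distr_PiM_component) (auto intro!: prob_space_normal_density)
    then show ?thesis by (subst (asm) integrable_distr_eq) auto
  qed
  then have "integrable ?P (\<lambda>x. \<Sum>i\<in>UNIV. \<bar>x i\<bar>)" by (intro Bochner_Integration.integrable_sum)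
  then have "integrable ?P (\<lambda>x. norm (\<chi> i. x i))"
  proof (rule Bochner_Integration.integrable_bound)
    show "AE x in ?P. norm (norm (\<chi> i. x i)) \<le> norm (\<Sum>i\<in>UNIV. \<bar>x i\<bar>)"
    proof (intro AE_I2)
      fix x :: "'d \<Rightarrow> real"
      show "norm (norm (\<chi> i. x i)) \<le> norm (\<Sum>i\<in>UNIV. \<bar>x i\<bar>)"
        using norm_le_l1_cart[of "\<chi> i. x i"] by (simp add: abs_of_nonneg[OF sum_nonneg])
    qed
  qed measurable
  then show ?thesis
    unfolding std_gaussian_def by (subst integrable_distr_eq) auto
qed

section \<open>A single compensated jump\<close>

text \<open>With \<open>drift\<close> below, this splits the generator into its jump part (up to the factor \<open>1 / \<lambda>\<close>) and
  its transport part along the Hamiltonian vector field.\<close>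

definition mean_jump :: "real \<Rightarrow> ('d::finite phase \<Rightarrow> real) \<Rightarrow> 'd phase \<Rightarrow> real" where
  "mean_jump \<phi> f z = (\<integral>x. f (momentum_refresh \<phi> z x) - f z \<partial>std_gaussian)"

definition drift :: "(real ^ 'd \<Rightarrow> real) \<Rightarrow> ('d::finite phase \<Rightarrow> real) \<Rightarrow> 'd phase \<Rightarrow> real" where
  "drift \<Phi> f z = snd z \<bullet> grad (\<lambda>q. f (q, snd z)) (fst z) - grad \<Phi> (fst z) \<bullet> grad (\<lambda>p. f (fst z, p)) (snd z)"

lemma rhmc_generator_eq_jump_plus_drift:
  "rhmc_generator lam \<phi> \<Phi> f z = 1 / lam * mean_jump \<phi> f z + drift \<Phi> f z"
  by (simp add: rhmc_generator_def mean_jump_def drift_def split: prod.split)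

lemma momentum_refresh_measurable [measurable]:
  "(\<lambda>(z, x). momentum_refresh \<phi> z x) \<in> borel \<Otimes>\<^sub>M borel \<rightarrow>\<^sub>M borel"
  unfolding momentum_refresh_def borel_prod split_beta
  by (intro borel_measurable_continuous_onI continuous_intros)

lemma drift_eq_derivative:
  assumes "(f has_derivative f') (at z)"
  shows "drift \<Phi> f z = f' (snd z, - grad \<Phi> (fst z))"
proof -
  interpret f': bounded_linear f' using assms by (rule has_derivative_bounded_linear)
  have z: "(fst z, snd z) = z" by simp
  have "((\<lambda>q. f (q, snd z)) has_derivative (\<lambda>h. f' (h, 0))) (at (fst z))"
    by (rule has_derivative_compose[of "\<lambda>q. (q, snd z)" "\<lambda>h. (h, 0)" "fst z" UNIV f f'])
       (use assms in \<open>auto intro!: derivative_eq_intros\<close>)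
  from has_derivative_imp_grad(2)[OF this, of "snd z"]
  have 1: "snd z \<bullet> grad (\<lambda>q. f (q, snd z)) (fst z) = f' (snd z, 0)" by simp
  have "((\<lambda>p. f (fst z, p)) has_derivative (\<lambda>h. f' (0, h))) (at (snd z))"
    by (rule has_derivative_compose[of "\<lambda>p. (fst z, p)" "\<lambda>h. (0, h)" "snd z" UNIV f f'])
       (use assms in \<open>auto intro!: derivative_eq_intros\<close>)
  from has_derivative_imp_grad(2)[OF this, of "- grad \<Phi> (fst z)"]
  have 2: "- (grad \<Phi> (fst z) \<bullet> grad (\<lambda>p. f (fst z, p)) (snd z)) = f' (0, - grad \<Phi> (fst z))" by simp
  show ?thesis
    using f'.add[of "(snd z, 0)" "(0, - grad \<Phi> (fst z))"] 1 2 by (simp add: drift_def)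
qed

abbreviation mean_gaussian_norm :: "'d::finite itself \<Rightarrow> real" where
  "mean_gaussian_norm _ \<equiv> \<integral>x. norm (x :: real ^ 'd) \<partial>std_gaussian"

lemma
  shows integrable_affine_norm_std_gaussian:
      "integrable std_gaussian (\<lambda>x. c * (a + norm (x :: real ^ 'd::finite)))"
    and integral_affine_norm_std_gaussian:
      "(\<integral>x. c * (a + norm (x :: real ^ 'd)) \<partial>std_gaussian) = c * (a + mean_gaussian_norm TYPE('d))"
proof -
  interpret prob_space "std_gaussian :: (real ^ 'd) measure" by (rule prob_space_std_gaussian)
  have 1: "integrable std_gaussian (\<lambda>x. a + norm (x :: real ^ 'd))"
    by (intro Bochner_Integration.integrable_add integrable_const integrable_norm_std_gaussian)
  then show "integrable std_gaussian (\<lambda>x. c * (a + norm (x :: real ^ 'd)))"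
    by (rule integrable_mult_right)
  have "(\<integral>x. a + norm (x :: real ^ 'd) \<partial>std_gaussian) = a + mean_gaussian_norm TYPE('d)"
    by (subst Bochner_Integration.integral_add[OF integrable_const integrable_norm_std_gaussian])
       (simp add: prob_space[unfolded space_std_gaussian])
  then show "(\<integral>x. c * (a + norm (x :: real ^ 'd)) \<partial>std_gaussian) = c * (a + mean_gaussian_norm TYPE('d))"
    by simp
qed

locale rhmc_dynamics = hamiltonian_dynamics \<Phi> \<theta>
  for \<Phi> :: "real ^ 'd::finite \<Rightarrow> real" and \<theta> :: "real \<Rightarrow> 'd phase \<Rightarrow> 'd phase" +
  fixes lam \<phi> :: real and f :: "'d phase \<Rightarrow> real" and C :: real
  assumes lam_pos: "lam > 0"
    and lipschitz: "C-lipschitz_on UNIV f"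
    and test_C1: "C1 f"
begin

abbreviation waiting_law :: "real measure" where
  "waiting_law \<equiv> density lborel (exponential_density (1 / lam))"

lemma C_nonneg: "0 \<le> C"
  using lipschitz lipschitz_on_nonneg by blast

lemma mean_gaussian_norm_nonneg: "0 \<le> mean_gaussian_norm TYPE('d)"
  by (simp add: integral_nonneg)

lemma test_measurable [measurable]: "f \<in> borel_measurable borel"
  by (intro borel_measurable_continuous_onI C1_imp_continuous test_C1)

lemma drift_continuous: "continuous_on UNIV (drift \<Phi> f)"
proof -
  from test_C1[unfolded C1_def] obtain f' where
      f': "\<forall>x. (f has_derivative blinfun_apply (f' x)) (at x)" and cont: "continuous_on UNIV f'"
    by (elim exE conjE)
  from f' have "(f has_derivative blinfun_apply (f' x)) (at x)" for x by (rule spec)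
  then have "drift \<Phi> f = (\<lambda>z. f' z (vector_field z))"
    by (intro ext drift_eq_derivative)
  moreover have "continuous_on UNIV (\<lambda>z. blinfun_apply (f' z) (vector_field z))"
    by (intro blinfun.continuous_on cont continuous_on_Pair continuous_on_minus
        continuous_on_snd continuous_on_id continuous_on_compose2[OF grad_potential_continuous[of UNIV]]
        continuous_on_fst subset_UNIV)
  ultimately show ?thesis by simp
qed

text \<open>This is why the transport part of the generator contributes no more to \<open>M\<^sup>f\<close> than increments of \<open>f\<close>.\<close>

lemma drift_along_flow:
  "((\<lambda>s. f (\<theta> s z)) has_real_derivative drift \<Phi> f (\<theta> s z)) (at s)"
proof -
  have D: "(f has_derivative (\<lambda>h. h \<bullet> grad f (\<theta> s z))) (at (\<theta> s z))"
    by (rule C1_has_derivative_grad[OF test_C1])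
  from vector_derivative_diff_chain_within[of "\<lambda>s. \<theta> s z" _ s UNIV f,
      OF flow_has_vector_derivative has_derivative_at_withinI[OF D]]
  show ?thesis
    by (simp add: has_real_derivative_iff_has_vector_derivative o_def drift_eq_derivative[OF D])
qed

lemma drift_integral_along_flow:
  assumes "0 \<le> u"
  shows "integrable lborel (\<lambda>r. indicator {0..<u} r * drift \<Phi> f (\<theta> r y))"
    and "(\<integral>r. indicator {0..<u} r * drift \<Phi> f (\<theta> r y) \<partial>lborel) = f (\<theta> u y) - f y"
proof -
  have cont: "continuous_on A (\<lambda>r. drift \<Phi> f (\<theta> r y))" for A
    by (intro continuous_on_compose2[OF drift_continuous] flow_continuous_time) auto
  have m [measurable]: "(\<lambda>r. drift \<Phi> f (\<theta> r y)) \<in> borel_measurable borel"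
    by (intro borel_measurable_continuous_onI cont)
  have FTC: "has_bochner_integral lborel (\<lambda>r. indicator {0..u} r *\<^sub>R drift \<Phi> f (\<theta> r y))
      (f (\<theta> u y) - f (\<theta> 0 y))"
  proof (rule has_bochner_integral_FTC_Icc[OF assms _ cont])
    fix r
    have "((\<lambda>s. f (\<theta> s y)) has_vector_derivative drift \<Phi> f (\<theta> r y)) (at r)"
      unfolding has_real_derivative_iff_has_vector_derivative[symmetric] by (rule drift_along_flow)
    then show "((\<lambda>s. f (\<theta> s y)) has_vector_derivative drift \<Phi> f (\<theta> r y)) (at r within {0..u})"
      by (rule has_vector_derivative_at_within)
  qed
  have "has_bochner_integral lborel (\<lambda>r. indicator {0..<u} r * drift \<Phi> f (\<theta> r y))
      (f (\<theta> u y) - f y)"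
  proof (rule has_bochner_integralI_AE[OF FTC[unfolded flow_zero]])
    have "AE r in lborel. r \<noteq> u" by (rule AE_lborel_singleton)
    then show "AE r in lborel. indicator {0..u} r *\<^sub>R drift \<Phi> f (\<theta> r y)
        = indicator {0..<u} r * drift \<Phi> f (\<theta> r y)"
      by eventually_elim (auto simp: indicator_def)
  qed measurable
  then show "integrable lborel (\<lambda>r. indicator {0..<u} r * drift \<Phi> f (\<theta> r y))"
    and "(\<integral>r. indicator {0..<u} r * drift \<Phi> f (\<theta> r y) \<partial>lborel) = f (\<theta> u y) - f y"
    by (auto simp: has_bochner_integral_iff)
qed

lemma jump_bound:
  "\<bar>f (momentum_refresh \<phi> z x) - f z\<bar> \<le> C * (2 * norm (snd z) + norm x)"
proof -
  have "\<bar>f (momentum_refresh \<phi> z x) - f z\<bar> \<le> C * norm (momentum_refresh \<phi> z x - z)"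
    using lipschitz_onD[OF lipschitz, of "momentum_refresh \<phi> z x" z] by (simp add: dist_norm)
  moreover have "norm (momentum_refresh \<phi> z x - z) = norm (cos \<phi> *\<^sub>R snd z + sin \<phi> *\<^sub>R x - snd z)"
    by (cases z) (simp add: momentum_refresh_def norm_Pair)
  moreover have "\<dots> \<le> \<bar>cos \<phi>\<bar> * norm (snd z) + \<bar>sin \<phi>\<bar> * norm x + norm (snd z)"
    by (intro norm_triangle_le_diff norm_triangle_le order_refl add_mono) auto
  moreover have "\<bar>cos \<phi>\<bar> * norm (snd z) \<le> norm (snd z)" "\<bar>sin \<phi>\<bar> * norm x \<le> norm x"
    by (intro mult_left_le_one_le; simp)+
  ultimately show ?thesis
    by (smt (verit) C_nonneg mult_left_mono)
qed

lemma jump_integrable: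
  "integrable std_gaussian (\<lambda>x. f (momentum_refresh \<phi> z x) - f z)"
proof -
  interpret prob_space "std_gaussian :: (real ^ 'd) measure" by (rule prob_space_std_gaussian)
  have "integrable std_gaussian (\<lambda>x. C * (2 * norm (snd z) + norm (x :: real ^ 'd)))"
    by (rule integrable_affine_norm_std_gaussian)
  then show ?thesis
    by (rule Bochner_Integration.integrable_bound)
       (measurable, use jump_bound C_nonneg in \<open>simp add: abs_mult\<close>)
qed

lemma mean_jump_bound: "\<bar>mean_jump \<phi> f z\<bar> \<le> C * (2 * norm (snd z) + mean_gaussian_norm TYPE('d))"
proof -
  interpret prob_space "std_gaussian :: (real ^ 'd) measure" by (rule prob_space_std_gaussian)
  have "\<bar>mean_jump \<phi> f z\<bar> \<le> (\<integral>x. \<bar>f (momentum_refresh \<phi> z x) - f z\<bar> \<partial>std_gaussian)"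
    unfolding mean_jump_def by (rule integral_abs_bound)
  also have "\<dots> \<le> (\<integral>x. C * (2 * norm (snd z) + norm (x :: real ^ 'd)) \<partial>std_gaussian)"
    by (intro integral_mono integrable_abs jump_integrable jump_bound integrable_affine_norm_std_gaussian)
  also have "\<dots> = C * (2 * norm (snd z) + mean_gaussian_norm TYPE('d))"
    by (rule integral_affine_norm_std_gaussian)
  finally show ?thesis .
qed

lemma mean_jump_measurable [measurable]: "mean_jump \<phi> f \<in> borel_measurable borel"
proof -
  interpret prob_space "std_gaussian :: (real ^ 'd) measure" by (rule prob_space_std_gaussian)
  show ?thesis unfolding mean_jump_def by measurable
qed

text \<open>As the norm of \<open>(sqrt (2 \<Phi>(q)), p)\<close>, the energy radius obeys the triangle inequality; the factors
  \<open>|cos \<phi>|\<close> and \<open>|sin \<phi>|\<close> are at most 1.\<close>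

lemma energy_radius_refresh:
  "energy_radius \<Phi> (momentum_refresh \<phi> z x) \<le> energy_radius \<Phi> z + norm x"
proof -
  let ?s = "sqrt (2 * \<Phi> (fst z))"
  have E: "energy_radius \<Phi> y = norm (sqrt (2 * \<Phi> (fst y)), snd y)" for y
    using potential_nonneg by (simp add: energy_radius_def norm_Pair)
  have "energy_radius \<Phi> (momentum_refresh \<phi> z x) = norm ((?s, cos \<phi> *\<^sub>R snd z) + (0, sin \<phi> *\<^sub>R x))"
    by (simp add: E momentum_refresh_def)
  also have "\<dots> \<le> norm (?s, cos \<phi> *\<^sub>R snd z) + norm (0 :: real, sin \<phi> *\<^sub>R x)"
    by (rule norm_triangle_ineq)
  also have "norm (?s, cos \<phi> *\<^sub>R snd z) \<le> norm (?s, snd z)"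
    by (simp add: norm_Pair power_mult_distrib mult_left_le_one_le abs_square_le_1)
  also have "norm (0 :: real, sin \<phi> *\<^sub>R x) \<le> norm x"
    by (simp add: norm_Pair mult_left_le_one_le)
  finally show ?thesis by (simp add: E)
qed

text \<open>The contribution to \<open>M\<^sup>f\<^sub>t\<close> of the flow segment that starts at time \<open>\<tau>\<close> in the state \<open>y\<close>, lasts for \<open>d\<close>
  and ends with a refreshment by the Gaussian vector \<open>x\<close>: the jump of \<open>f\<close>, if it occurs by time \<open>t\<close>,
  minus the jump rate accumulated along the part of the segment before \<open>t\<close>.\<close>

definition compensated_jump :: "real \<Rightarrow> 'd phase \<Rightarrow> real \<Rightarrow> real \<Rightarrow> real ^ 'd \<Rightarrow> real" where
  "compensated_jump t y \<tau> d x =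
     indicator {..t} (\<tau> + d) * (f (momentum_refresh \<phi> (\<theta> d y) x) - f (\<theta> d y))
     - 1 / lam * (\<integral>r. indicator {0..<d} r * (indicator {..t} (\<tau> + r) * mean_jump \<phi> f (\<theta> r y)) \<partial>lborel)"

lemma compensated_jump_measurable [measurable]:
  "(\<lambda>(y, \<tau>, d, x). compensated_jump t y \<tau> d x)
     \<in> borel_measurable (borel \<Otimes>\<^sub>M borel \<Otimes>\<^sub>M borel \<Otimes>\<^sub>M borel)"
  unfolding compensated_jump_def indicator_def atLeastLessThan_iff atMost_iff by measurable

lemma compensator_bound:
  "\<bar>indicator {..t} (\<tau> + r) * mean_jump \<phi> f (\<theta> r y)\<bar>
     \<le> C * (2 * energy_radius \<Phi> y + mean_gaussian_norm TYPE('d))"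
proof -
  have "\<bar>indicator {..t} (\<tau> + r) * mean_jump \<phi> f (\<theta> r y)\<bar> \<le> \<bar>mean_jump \<phi> f (\<theta> r y)\<bar>"
    by (auto simp: indicator_def)
  also have "\<dots> \<le> C * (2 * norm (snd (\<theta> r y)) + mean_gaussian_norm TYPE('d))" by (rule mean_jump_bound)
  also have "\<dots> \<le> C * (2 * energy_radius \<Phi> y + mean_gaussian_norm TYPE('d))"
    using norm_momentum_flow_le C_nonneg by (intro mult_left_mono add_mono) auto
  finally show ?thesis .
qed

lemma flow_curve_measurable [measurable]: "(\<lambda>r. \<theta> r y) \<in> borel_measurable borel"
  by (intro borel_measurable_continuous_onI flow_continuous_time)

lemma compensator_integrable:
  "integrable lborel (\<lambda>r. indicator {0..} r * (indicator {..t} (\<tau> + r) * mean_jump \<phi> f (\<theta> r y)))"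
proof (rule Bochner_Integration.integrable_bound)
  show "integrable lborel (\<lambda>r. indicator {0..t - \<tau>} r * (C * (2 * energy_radius \<Phi> y + mean_gaussian_norm TYPE('d))))"
    by (intro integrable_mult_left integrable_real_indicator) (auto simp: emeasure_lborel_Icc_eq)
  show "AE r in lborel. norm (indicator {0..} r * (indicator {..t} (\<tau> + r) * mean_jump \<phi> f (\<theta> r y)))
     \<le> norm (indicator {0..t - \<tau>} r * (C * (2 * energy_radius \<Phi> y + mean_gaussian_norm TYPE('d))))"
  proof (intro AE_I2)
    fix r
    show "norm (indicator {0..} r * (indicator {..t} (\<tau> + r) * mean_jump \<phi> f (\<theta> r y)))
     \<le> norm (indicator {0..t - \<tau>} r * (C * (2 * energy_radius \<Phi> y + mean_gaussian_norm TYPE('d))))"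
      using compensator_bound[of t \<tau> r y] by (auto simp: indicator_def split: if_splits)
  qed
qed measurable

lemma compensator_integrable_until:
  "integrable lborel (\<lambda>r. indicator {0..<d} r * (indicator {..t} (\<tau> + r) * mean_jump \<phi> f (\<theta> r y)))"
  by (rule Bochner_Integration.integrable_bound[OF compensator_integrable[of t \<tau> y]])
     (measurable, auto simp: indicator_def)

text \<open>A segment that starts after \<open>t\<close> contributes nothing; otherwise the compensator lives on an
  interval of length at most \<open>t - \<tau>\<close>, and momenta along the segment are bounded by the energy radius.\<close>

lemma compensated_jump_bound:
  assumes "0 \<le> d"
  shows "\<bar>compensated_jump t y \<tau> d x\<bar> \<le> indicator {..t} \<tau> *
     (C * (2 * energy_radius \<Phi> y + norm x)
       + (t - \<tau>) / lam * (C * (2 * energy_radius \<Phi> y + mean_gaussian_norm TYPE('d))))"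
proof (cases "\<tau> \<le> t")
  case False
  then have "(\<lambda>r. indicator {0..<d} r * (indicator {..t} (\<tau> + r) * mean_jump \<phi> f (\<theta> r y))) = (\<lambda>r. 0)"
    by (auto simp: indicator_def fun_eq_iff)
  then show ?thesis using False assms by (simp add: compensated_jump_def)
next
  case True
  let ?B = "C * (2 * energy_radius \<Phi> y + mean_gaussian_norm TYPE('d))"
  let ?w = "\<lambda>r. indicator {0..<d} r * (indicator {..t} (\<tau> + r) * mean_jump \<phi> f (\<theta> r y))"
  have "\<bar>f (momentum_refresh \<phi> (\<theta> d y) x) - f (\<theta> d y)\<bar> \<le> C * (2 * norm (snd (\<theta> d y)) + norm x)"
    by (rule jump_bound)
  also have "\<dots> \<le> C * (2 * energy_radius \<Phi> y + norm x)"
    using norm_momentum_flow_le C_nonneg by (intro mult_left_mono add_mono) auto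
  finally have 1: "\<bar>indicator {..t} (\<tau> + d) * (f (momentum_refresh \<phi> (\<theta> d y) x) - f (\<theta> d y))\<bar>
      \<le> C * (2 * energy_radius \<Phi> y + norm x)"
    using C_nonneg energy_radius_nonneg[of y] by (auto simp: indicator_def)
  have "\<bar>\<integral>r. ?w r \<partial>lborel\<bar> \<le> (\<integral>r. \<bar>?w r\<bar> \<partial>lborel)" by (rule integral_abs_bound)
  also have "\<dots> \<le> (\<integral>r. indicator {0..t - \<tau>} r * ?B \<partial>lborel)"
  proof (intro integral_mono integrable_abs compensator_integrable_until)
    show "\<bar>?w r\<bar> \<le> indicator {0..t - \<tau>} r * ?B" for r
      using compensator_bound[of t \<tau> r y] by (auto simp: indicator_def split: if_splits)
  qed (intro integrable_mult_left integrable_real_indicator, auto simp: emeasure_lborel_Icc_eq)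
  also have "\<dots> = (t - \<tau>) * ?B" using True by simp
  finally have 2: "\<bar>1 / lam * (\<integral>r. ?w r \<partial>lborel)\<bar> \<le> (t - \<tau>) / lam * ?B"
    using lam_pos by (simp add: abs_mult divide_right_mono)
  show ?thesis
    unfolding compensated_jump_def
    using True order_trans[OF abs_triangle_ineq4 add_mono[OF 1 2]] by simp
qed

text \<open>Averaging the jump over the Gaussian vector turns \<open>f \<circ> \<Gamma> - f\<close> into \<open>mean_jump\<close>, evaluated at the
  end of the segment; the average of that over the exponential duration is the average of the
  compensator by \<open>exponential_compensator\<close>.\<close>

lemma compensated_jump_mean_zero:
  shows "integrable (waiting_law \<Otimes>\<^sub>M std_gaussian) (\<lambda>(d, x). compensated_jump t y \<tau> d x)"
    and "(\<integral>(d, x). compensated_jump t y \<tau> d x \<partial>(waiting_law \<Otimes>\<^sub>M std_gaussian)) = 0"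
proof -
  have l: "1 / lam > 0" using lam_pos by simp
  interpret E: prob_space waiting_law by (rule prob_space_exponential_density[OF l])
  interpret G: prob_space "std_gaussian :: (real ^ 'd) measure" by (rule prob_space_std_gaussian)
  interpret pair_sigma_finite waiting_law "std_gaussian :: (real ^ 'd) measure" ..
  let ?w = "\<lambda>r. indicator {..t} (\<tau> + r) * mean_jump \<phi> f (\<theta> r y)"
  let ?h = "\<lambda>d. 1 / lam * (\<integral>r. indicator {0..<d} r * ?w r \<partial>lborel)"
  let ?g = "\<lambda>d x. indicator {..t} (\<tau> + d) * (f (momentum_refresh \<phi> (\<theta> d y) x) - f (\<theta> d y))"
  have w [measurable]: "?w \<in> borel_measurable borel"
    unfolding indicator_def atMost_iff by measurable
  note compensator = exponential_compensator[OF l w compensator_integrable]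
  have h_int: "integrable waiting_law ?h" using compensator(2) by simp
  have h_pair: "integrable (waiting_law \<Otimes>\<^sub>M std_gaussian) (\<lambda>(d, x :: real ^ 'd). ?h d)"
  proof (rule Fubini_integrable)
    show "integrable waiting_law (\<lambda>d. \<integral>x. norm (case (d, x) of (d, x :: real ^ 'd) \<Rightarrow> ?h d) \<partial>std_gaussian)"
      using integrable_norm[OF h_int] by (simp add: G.prob_space[unfolded space_std_gaussian])
  qed (use h_int in \<open>auto simp: borel_measurable_integrable\<close>)
  have g_int: "integrable std_gaussian (?g d)" for d
    by (intro integrable_mult_right jump_integrable)
  have gm [measurable]: "case_prod ?g \<in> borel_measurable (waiting_law \<Otimes>\<^sub>M std_gaussian)"
    unfolding indicator_def atMost_iff by measurable
  have g_pair: "integrable (waiting_law \<Otimes>\<^sub>M std_gaussian) (case_prod ?g)"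
  proof (rule Fubini_integrable)
    show "integrable waiting_law (\<lambda>d. \<integral>x. norm (case_prod ?g (d, x)) \<partial>std_gaussian)"
    proof (rule E.integrable_const_bound)
      have "(\<integral>x. norm (?g d x) \<partial>std_gaussian) \<le> C * (2 * energy_radius \<Phi> y + mean_gaussian_norm TYPE('d))" for d
      proof -
        have "norm (?g d x) \<le> C * (2 * energy_radius \<Phi> y + norm x)" for x
        proof -
          have "norm (?g d x) \<le> C * (2 * norm (snd (\<theta> d y)) + norm x)"
            using jump_bound[of "\<theta> d y" x] by (auto simp: indicator_def)
          also have "\<dots> \<le> C * (2 * energy_radius \<Phi> y + norm x)"
            using norm_momentum_flow_le C_nonneg by (intro mult_left_mono add_mono) auto
          finally show ?thesis .
        qed
        then have "(\<integral>x. norm (?g d x) \<partial>std_gaussian)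
            \<le> (\<integral>x. C * (2 * energy_radius \<Phi> y + norm (x :: real ^ 'd)) \<partial>std_gaussian)"
          by (intro integral_mono integrable_norm g_int integrable_affine_norm_std_gaussian)
        also have "\<dots> = C * (2 * energy_radius \<Phi> y + mean_gaussian_norm TYPE('d))"
          by (rule integral_affine_norm_std_gaussian)
        finally show ?thesis .
      qed
      then show "AE d in waiting_law. norm (\<integral>x. norm (case_prod ?g (d, x)) \<partial>std_gaussian)
          \<le> C * (2 * energy_radius \<Phi> y + mean_gaussian_norm TYPE('d))"
        by (intro AE_I2) (simp add: integral_nonneg)
    qed measurable
  qed (use g_int in simp_all)
  have eq: "(\<lambda>(d, x). compensated_jump t y \<tau> d x) = (\<lambda>p. case_prod ?g p - (case p of (d, x) \<Rightarrow> ?h d))"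
    by (simp add: compensated_jump_def fun_eq_iff)
  show "integrable (waiting_law \<Otimes>\<^sub>M std_gaussian) (\<lambda>(d, x). compensated_jump t y \<tau> d x)"
    unfolding eq by (rule Bochner_Integration.integrable_diff[OF g_pair h_pair])
  have "(\<integral>p. case_prod ?g p \<partial>(waiting_law \<Otimes>\<^sub>M std_gaussian)) = (\<integral>d. (\<integral>x. ?g d x \<partial>std_gaussian) \<partial>waiting_law)"
    using integral_fst'[OF g_pair] by simp
  also have "\<dots> = (\<integral>d. ?w d \<partial>waiting_law)" by (simp add: mean_jump_def)
  also have "\<dots> = (\<integral>d. ?h d \<partial>waiting_law)" using compensator(3) by simp
  also have "\<dots> = (\<integral>d. (\<integral>x. ?h d \<partial>(std_gaussian :: (real ^ 'd) measure)) \<partial>waiting_law)"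
    by (simp add: G.prob_space[unfolded space_std_gaussian])
  also have "\<dots> = (\<integral>p. (case p of (d, x :: real ^ 'd) \<Rightarrow> ?h d) \<partial>(waiting_law \<Otimes>\<^sub>M std_gaussian))"
    using integral_fst'[OF h_pair] by (simp only: prod.case)
  finally show "(\<integral>(d, x). compensated_jump t y \<tau> d x \<partial>(waiting_law \<Otimes>\<^sub>M std_gaussian)) = 0"
    unfolding eq Bochner_Integration.integral_diff[OF g_pair h_pair] by (simp only: diff_self)
qed

text \<open>The segment is cut at time \<open>t\<close>. Up to the null set \<open>{t - \<tau>}\<close> the remaining interval is
  \<open>[0, min d (t - \<tau>))\<close>, to which the fundamental theorem of calculus applies.\<close>

lemma drift_integral_truncated:
  assumes "0 \<le> d" "\<tau> \<le> t"
  shows "integrable lborel (\<lambda>r. indicator {0..<d} r * (indicator {..t} (\<tau> + r) * drift \<Phi> f (\<theta> r y)))"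
    and "(\<integral>r. indicator {0..<d} r * (indicator {..t} (\<tau> + r) * drift \<Phi> f (\<theta> r y)) \<partial>lborel)
      = f (\<theta> (min d (t - \<tau>)) y) - f y"
proof -
  have [measurable]: "(\<lambda>r. drift \<Phi> f (\<theta> r y)) \<in> borel_measurable borel"
    by (intro borel_measurable_continuous_onI continuous_on_compose2[OF drift_continuous]
        flow_continuous_time subset_UNIV)
  have "0 \<le> min d (t - \<tau>)" using assms by simp
  note drift_integral_along_flow[OF this, of y]
  then have "has_bochner_integral lborel (\<lambda>r. indicator {0..<min d (t - \<tau>)} r * drift \<Phi> f (\<theta> r y))
      (f (\<theta> (min d (t - \<tau>)) y) - f y)"
    by (simp add: has_bochner_integral_iff)
  then have "has_bochner_integral lborel
      (\<lambda>r. indicator {0..<d} r * (indicator {..t} (\<tau> + r) * drift \<Phi> f (\<theta> r y)))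
      (f (\<theta> (min d (t - \<tau>)) y) - f y)"
  proof (rule has_bochner_integralI_AE)
    have "AE r in lborel. r \<noteq> t - \<tau>" by (rule AE_lborel_singleton)
    then show "AE r in lborel. indicator {0..<min d (t - \<tau>)} r * drift \<Phi> f (\<theta> r y)
        = indicator {0..<d} r * (indicator {..t} (\<tau> + r) * drift \<Phi> f (\<theta> r y))"
      by eventually_elim (auto simp: indicator_def)
  qed measurable
  then show "integrable lborel (\<lambda>r. indicator {0..<d} r * (indicator {..t} (\<tau> + r) * drift \<Phi> f (\<theta> r y)))"
    and "(\<integral>r. indicator {0..<d} r * (indicator {..t} (\<tau> + r) * drift \<Phi> f (\<theta> r y)) \<partial>lborel)
      = f (\<theta> (min d (t - \<tau>)) y) - f y"
    by (auto simp: has_bochner_integral_iff)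
qed

text \<open>Trading the jump rate for the full generator costs the transport integral, which is an increment
  of \<open>f\<close>. This form telescopes when it is summed over consecutive segments.\<close>

lemma compensated_jump_eq_generator:
  assumes "0 \<le> d" "\<tau> \<le> t"
  shows "integrable lborel
      (\<lambda>r. indicator {0..<d} r * (indicator {..t} (\<tau> + r) * rhmc_generator lam \<phi> \<Phi> f (\<theta> r y)))"
    and "compensated_jump t y \<tau> d x =
      indicator {..t} (\<tau> + d) * (f (momentum_refresh \<phi> (\<theta> d y) x) - f (\<theta> d y))
      + (f (\<theta> (min d (t - \<tau>)) y) - f y)
      - (\<integral>r. indicator {0..<d} r * (indicator {..t} (\<tau> + r) * rhmc_generator lam \<phi> \<Phi> f (\<theta> r y)) \<partial>lborel)"
proof -
  have split: "(\<lambda>r. indicator {0..<d} r * (indicator {..t} (\<tau> + r) * rhmc_generator lam \<phi> \<Phi> f (\<theta> r y)))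
    = (\<lambda>r. 1 / lam * (indicator {0..<d} r * (indicator {..t} (\<tau> + r) * mean_jump \<phi> f (\<theta> r y)))
         + indicator {0..<d} r * (indicator {..t} (\<tau> + r) * drift \<Phi> f (\<theta> r y)))"
    by (simp add: rhmc_generator_eq_jump_plus_drift algebra_simps)
  have 1: "integrable lborel
      (\<lambda>r. 1 / lam * (indicator {0..<d} r * (indicator {..t} (\<tau> + r) * mean_jump \<phi> f (\<theta> r y))))"
    by (intro integrable_mult_right compensator_integrable_until)
  note 2 = drift_integral_truncated[OF assms, of y]
  show "integrable lborel
      (\<lambda>r. indicator {0..<d} r * (indicator {..t} (\<tau> + r) * rhmc_generator lam \<phi> \<Phi> f (\<theta> r y)))"
    unfolding split by (rule Bochner_Integration.integrable_add[OF 1 2(1)])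
  show "compensated_jump t y \<tau> d x =
      indicator {..t} (\<tau> + d) * (f (momentum_refresh \<phi> (\<theta> d y) x) - f (\<theta> d y))
      + (f (\<theta> (min d (t - \<tau>)) y) - f y)
      - (\<integral>r. indicator {0..<d} r * (indicator {..t} (\<tau> + r) * rhmc_generator lam \<phi> \<Phi> f (\<theta> r y)) \<partial>lborel)"
    unfolding split Bochner_Integration.integral_add[OF 1 2(1)] 2(2) compensated_jump_def by simp
qed

lemma compensated_jump_stops:
  assumes "\<tau> + d \<le> s" "s \<le> t"
  shows "compensated_jump t y \<tau> d x = compensated_jump s y \<tau> d x"
proof -
  have "(\<lambda>r. indicator {0..<d} r * (indicator {..t} (\<tau> + r) * mean_jump \<phi> f (\<theta> r y)))
      = (\<lambda>r. indicator {0..<d} r * (indicator {..s} (\<tau> + r) * mean_jump \<phi> f (\<theta> r y)))"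
    using assms by (auto simp: fun_eq_iff indicator_def)
  moreover have "indicator {..t} (\<tau> + d) = (indicator {..s} (\<tau> + d) :: real)"
    using assms by (simp add: indicator_def)
  ultimately show ?thesis unfolding compensated_jump_def by simp
qed

lemma rhmc_generator_measurable: "rhmc_generator lam \<phi> \<Phi> f \<in> borel_measurable borel"
proof -
  have [measurable]: "drift \<Phi> f \<in> borel_measurable borel"
    by (intro borel_measurable_continuous_onI drift_continuous)
  have "rhmc_generator lam \<phi> \<Phi> f = (\<lambda>z. 1 / lam * mean_jump \<phi> f z + drift \<Phi> f z)"
    by (rule ext) (rule rhmc_generator_eq_jump_plus_drift)
  then show ?thesis by simp
qed

end

section \<open>Independence of past and present noise\<close>

lemma Int_stable_vimage_sets: "Int_stable {X -` A \<inter> \<Omega> | A. A \<in> sets N}"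
proof (rule Int_stableI)
  fix a b assume "a \<in> {X -` A \<inter> \<Omega> | A. A \<in> sets N}" "b \<in> {X -` A \<inter> \<Omega> | A. A \<in> sets N}"
  then obtain A B where "A \<in> sets N" "B \<in> sets N" "a = X -` A \<inter> \<Omega>" "b = X -` B \<inter> \<Omega>"
    by (elim CollectE exE conjE)
  then have "A \<inter> B \<in> sets N" "a \<inter> b = X -` (A \<inter> B) \<inter> \<Omega>" by auto
  then show "a \<inter> b \<in> {X -` A \<inter> \<Omega> | A. A \<in> sets N}" by (intro CollectI exI[of _ "A \<inter> B"] conjI)
qed

context rhmc_process
begin

text \<open>Waiting times and Gaussian vectors have different types; indexing their generated event families by
  \<open>nat + nat\<close> allows to speak of the information in an arbitrary subset of the noise variables.\<close>

definition noise_events :: "nat + nat \<Rightarrow> 'w set set" where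
  "noise_events = case_sum (\<lambda>n. {\<delta> n -` A \<inter> space M | A. A \<in> sets borel})
                           (\<lambda>n. {\<xi> n -` A \<inter> space M | A. A \<in> sets borel})"

definition noise_algebra :: "(nat + nat) set \<Rightarrow> 'w measure" where
  "noise_algebra I = sigma (space M) (\<Union>i\<in>I. noise_events i)"

lemma waiting_time_measurable [measurable]: "\<delta> n \<in> borel_measurable M"
  using distributed_measurable[OF waiting_times[of n]] by simp

lemma gaussian_measurable [measurable]: "\<xi> n \<in> borel_measurable M"
  by (rule gaussians_measurable)

lemma noise_events_space: "(\<Union>i\<in>I. noise_events i) \<subseteq> Pow (space M)"
  by (auto simp: noise_events_def split: sum.splits)

lemma noise_events_events: "(\<Union>i\<in>I. noise_events i) \<subseteq> events"
  by (auto simp: noise_events_def split: sum.splits)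

lemma space_noise_algebra [simp]: "space (noise_algebra I) = space M"
  by (simp add: noise_algebra_def noise_events_space)

lemma sets_noise_algebra: "sets (noise_algebra I) = sigma_sets (space M) (\<Union>i\<in>I. noise_events i)"
  by (simp add: noise_algebra_def noise_events_space)

lemma noise_algebra_subalgebra: "subalgebra M (noise_algebra I)"
  unfolding subalgebra_def sets_noise_algebra
  by (auto intro!: sets.sigma_sets_subset noise_events_events)

lemma noise_algebra_mono: "I \<subseteq> J \<Longrightarrow> sets (noise_algebra I) \<subseteq> sets (noise_algebra J)"
  unfolding sets_noise_algebra by (intro sigma_sets_mono') blast

lemma waiting_time_noise_algebra:
  assumes "Inl n \<in> I"
  shows "\<delta> n \<in> borel_measurable (noise_algebra I)"
proof (rule measurableI)
  fix A :: "real set" assume "A \<in> sets borel"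
  then have "\<delta> n -` A \<inter> space M \<in> noise_events (Inl n)"
    unfolding noise_events_def sum.case by (intro CollectI exI[of _ A] conjI) simp_all
  then show "\<delta> n -` A \<inter> space (noise_algebra I) \<in> sets (noise_algebra I)"
    using assms by (auto simp: sets_noise_algebra intro!: sigma_sets.Basic)
qed simp

lemma gaussian_noise_algebra:
  assumes "Inr n \<in> I"
  shows "\<xi> n \<in> borel_measurable (noise_algebra I)"
proof (rule measurableI)
  fix A :: "(real ^ 'd) set" assume "A \<in> sets borel"
  then have "\<xi> n -` A \<inter> space M \<in> noise_events (Inr n)"
    unfolding noise_events_def sum.case by (intro CollectI exI[of _ A] conjI) simp_all
  then show "\<xi> n -` A \<inter> space (noise_algebra I) \<in> sets (noise_algebra I)"
    using assms by (auto simp: sets_noise_algebra intro!: sigma_sets.Basic)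
qed simp

lemma Int_stable_noise_events: "Int_stable (noise_events i)"
  by (cases i) (simp_all add: noise_events_def Int_stable_vimage_sets)

lemma noise_algebra_independent:
  assumes disj: "I \<inter> J = {}" and A: "A \<in> sets (noise_algebra I)" and B: "B \<in> sets (noise_algebra J)"
  shows "prob (A \<inter> B) = prob A * prob B"
proof -
  have "indep_sets (\<lambda>j. sigma_sets (space M) (\<Union>i\<in>case_bool I J j. noise_events i)) UNIV"
  proof (rule indep_sets_collect_sigma[OF _ Int_stable_noise_events])
    show "indep_sets noise_events (\<Union>j. case_bool I J j)"
      using indep_sets_mono_index[OF subset_UNIV independence] by (simp add: noise_events_def)
    show "disjoint_family_on (case_bool I J) UNIV"
      using disj by (auto simp: disjoint_family_on_def split: bool.splits)
  qed
  then have "indep_set (sets (noise_algebra I)) (sets (noise_algebra J))"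
    unfolding indep_set_def sets_noise_algebra
    by (rule indep_sets_mono_sets) (auto split: bool.splits)
  with A B show ?thesis by (simp add: indep_sets2_eq)
qed

definition past :: "nat \<Rightarrow> 'w measure" where
  "past n = noise_algebra (Inl ` {..<n} \<union> Inr ` {..<n})"

lemma space_past [simp]: "space (past n) = space M"
  by (simp add: past_def)

lemma past_subalgebra: "subalgebra M (past n)"
  unfolding past_def by (rule noise_algebra_subalgebra)

lemma measurable_past_imp: "Y \<in> past n \<rightarrow>\<^sub>M N \<Longrightarrow> Y \<in> M \<rightarrow>\<^sub>M N"
  using measurable_from_subalg[OF past_subalgebra] .

lemma measurable_past_mono:
  assumes "Y \<in> past m \<rightarrow>\<^sub>M N" "m \<le> n"
  shows "Y \<in> past n \<rightarrow>\<^sub>M N"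
proof (rule measurable_from_subalg[OF _ assms(1)])
  show "subalgebra (past n) (past m)"
    unfolding subalgebra_def using assms(2)
    by (auto simp: past_def intro: subsetD[OF noise_algebra_mono, rotated])
qed

lemma waiting_time_past: "k < n \<Longrightarrow> \<delta> k \<in> borel_measurable (past n)"
  unfolding past_def by (rule waiting_time_noise_algebra) simp

lemma gaussian_past: "k < n \<Longrightarrow> \<xi> k \<in> borel_measurable (past n)"
  unfolding past_def by (rule gaussian_noise_algebra) simp

lemma jump_time_past: "(\<lambda>\<omega>. jump_time (\<lambda>k. \<delta> k \<omega>) n) \<in> borel_measurable (past n)"
  unfolding jump_time_def by (intro borel_measurable_sum waiting_time_past) simp

text \<open>The Borel sets of the pair are generated by the noise variables \<open>Inl n\<close> and \<open>Inr n\<close>, which are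
  disjoint from those that generate the past.\<close>

lemma present_independent_of_past:
  assumes A: "A \<in> sets (past n)" and B: "B \<in> sets (borel \<Otimes>\<^sub>M borel)"
  shows "prob (A \<inter> {\<omega> \<in> space M. (\<delta> n \<omega>, \<xi> n \<omega>) \<in> B})
     = prob A * prob {\<omega> \<in> space M. (\<delta> n \<omega>, \<xi> n \<omega>) \<in> B}"
proof (rule noise_algebra_independent[OF _ A[unfolded past_def]])
  let ?J = "{Inl n, Inr n}"
  show "(Inl ` {..<n} \<union> Inr ` {..<n}) \<inter> ?J = {}" by auto
  have "(\<lambda>\<omega>. (\<delta> n \<omega>, \<xi> n \<omega>)) \<in> noise_algebra ?J \<rightarrow>\<^sub>M borel \<Otimes>\<^sub>M borel"
    by (intro measurable_Pair waiting_time_noise_algebra gaussian_noise_algebra) auto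
  from measurable_sets[OF this B]
  show "{\<omega> \<in> space M. (\<delta> n \<omega>, \<xi> n \<omega>) \<in> B} \<in> sets (noise_algebra ?J)"
    by (simp add: vimage_def Int_def conj_commute)
qed

lemma present_law:
  assumes "1 / lam > 0"
  shows "distr M (borel \<Otimes>\<^sub>M borel) (\<lambda>\<omega>. (\<delta> n \<omega>, \<xi> n \<omega>))
     = density lborel (exponential_density (1 / lam)) \<Otimes>\<^sub>M std_gaussian"
proof (rule pair_measure_eqI[symmetric])
  let ?W = "density lborel (exponential_density (1 / lam))"
  interpret W: prob_space ?W by (rule prob_space_exponential_density[OF assms])
  interpret G: prob_space "std_gaussian :: (real ^ 'd) measure" by (rule prob_space_std_gaussian)
  show "sigma_finite_measure ?W" "sigma_finite_measure (std_gaussian :: (real ^ 'd) measure)" ..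
  show "sets (?W \<Otimes>\<^sub>M std_gaussian) = sets (distr M (borel \<Otimes>\<^sub>M borel) (\<lambda>\<omega>. (\<delta> n \<omega>, \<xi> n \<omega>)))"
    by (simp cong: sets_pair_measure_cong)
  fix A :: "real set" and B :: "(real ^ 'd) set"
  assume "A \<in> sets ?W" "B \<in> sets std_gaussian"
  then have [measurable]: "A \<in> sets borel" "B \<in> sets borel" by simp_all
  let ?A = "\<delta> n -` A \<inter> space M" and ?B = "\<xi> n -` B \<inter> space M"
  have W: "emeasure ?W A = emeasure M ?A"
    using distributed_distr_eq_density[OF waiting_times[of n]]
    by (subst emeasure_distr[symmetric, of _ _ lborel]) auto
  have G: "emeasure std_gaussian B = emeasure M ?B"
    by (subst gaussians[of n, symmetric], subst emeasure_distr) auto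
  have "prob (?A \<inter> ?B) = prob ?A * prob ?B"
    by (rule noise_algebra_independent[of "{Inl n}" "{Inr n}"])
       (auto intro!: measurable_sets[OF waiting_time_noise_algebra, unfolded space_noise_algebra]
         measurable_sets[OF gaussian_noise_algebra, unfolded space_noise_algebra])
  moreover have "(\<lambda>\<omega>. (\<delta> n \<omega>, \<xi> n \<omega>)) -` (A \<times> B) \<inter> space M = ?A \<inter> ?B" by auto
  ultimately show "emeasure ?W A * emeasure std_gaussian B
      = emeasure (distr M (borel \<Otimes>\<^sub>M borel) (\<lambda>\<omega>. (\<delta> n \<omega>, \<xi> n \<omega>))) (A \<times> B)"
    by (subst emeasure_distr) (auto simp: W G emeasure_eq_measure ennreal_mult'')
qed

text \<open>A random variable depending on the noise before the \<open>n\<close>-th segment, paired with the noise of that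
  segment, has a product law. This lets Fubini replace conditioning on the past.\<close>

lemma past_present_law:
  assumes lam: "1 / lam > 0" and Y: "Y \<in> past n \<rightarrow>\<^sub>M N"
  shows "distr M (N \<Otimes>\<^sub>M (borel \<Otimes>\<^sub>M borel)) (\<lambda>\<omega>. (Y \<omega>, \<delta> n \<omega>, \<xi> n \<omega>))
     = distr M N Y \<Otimes>\<^sub>M (density lborel (exponential_density (1 / lam)) \<Otimes>\<^sub>M std_gaussian)"
proof (rule pair_measure_eqI[symmetric])
  let ?P = "density lborel (exponential_density (1 / lam)) \<Otimes>\<^sub>M (std_gaussian :: (real ^ 'd) measure)"
  have P: "?P = distr M (borel \<Otimes>\<^sub>M borel) (\<lambda>\<omega>. (\<delta> n \<omega>, \<xi> n \<omega>))"
    by (rule present_law[OF lam, symmetric])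
  have Ym [measurable]: "Y \<in> M \<rightarrow>\<^sub>M N" by (rule measurable_past_imp[OF Y])
  interpret P: prob_space ?P unfolding P by (rule prob_space_distr) measurable
  interpret Y: prob_space "distr M N Y" by (rule prob_space_distr) measurable
  show "sigma_finite_measure (distr M N Y)" "sigma_finite_measure ?P" ..
  show "sets (distr M N Y \<Otimes>\<^sub>M ?P)
      = sets (distr M (N \<Otimes>\<^sub>M (borel \<Otimes>\<^sub>M borel)) (\<lambda>\<omega>. (Y \<omega>, \<delta> n \<omega>, \<xi> n \<omega>)))"
    by (simp cong: sets_pair_measure_cong)
  fix A B assume A: "A \<in> sets (distr M N Y)" and B: "B \<in> sets ?P"
  then have A' [measurable]: "A \<in> sets N" and B' [measurable]: "B \<in> sets (borel \<Otimes>\<^sub>M borel)"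
    by (simp_all cong: sets_pair_measure_cong)
  let ?A = "Y -` A \<inter> space M" and ?B = "{\<omega> \<in> space M. (\<delta> n \<omega>, \<xi> n \<omega>) \<in> B}"
  have "?A \<in> sets (past n)" using measurable_sets[OF Y A'] by simp
  from present_independent_of_past[OF this B'] have "prob (?A \<inter> ?B) = prob ?A * prob ?B" .
  moreover have "(\<lambda>\<omega>. (Y \<omega>, \<delta> n \<omega>, \<xi> n \<omega>)) -` (A \<times> B) \<inter> space M = ?A \<inter> ?B" by auto
  moreover have "(\<lambda>\<omega>. (\<delta> n \<omega>, \<xi> n \<omega>)) -` B \<inter> space M = ?B" by auto
  ultimately show "emeasure (distr M N Y) A * emeasure ?P B
      = emeasure (distr M (N \<Otimes>\<^sub>M (borel \<Otimes>\<^sub>M borel)) (\<lambda>\<omega>. (Y \<omega>, \<delta> n \<omega>, \<xi> n \<omega>))) (A \<times> B)"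
    unfolding P by (simp add: emeasure_distr emeasure_eq_measure ennreal_mult'')
qed

lemma
  fixes Y :: "'w \<Rightarrow> real" and g :: "real \<Rightarrow> real ^ 'd \<Rightarrow> real"
  assumes Y: "Y \<in> borel_measurable (past n)" "integrable M Y"
    and g: "(\<lambda>(d, x). g d x) \<in> borel_measurable (borel \<Otimes>\<^sub>M borel)" "integrable M (\<lambda>\<omega>. g (\<delta> n \<omega>) (\<xi> n \<omega>))"
  shows integrable_past_times_present: "integrable M (\<lambda>\<omega>. Y \<omega> * g (\<delta> n \<omega>) (\<xi> n \<omega>))"
    and expectation_past_times_present:
      "expectation (\<lambda>\<omega>. Y \<omega> * g (\<delta> n \<omega>) (\<xi> n \<omega>)) = expectation Y * expectation (\<lambda>\<omega>. g (\<delta> n \<omega>) (\<xi> n \<omega>))"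
proof -
  let ?g = "\<lambda>\<omega>. g (\<delta> n \<omega>) (\<xi> n \<omega>)"
  have gm: "?g \<in> borel_measurable M"
    using measurable_compose[OF measurable_Pair[OF waiting_time_measurable gaussian_measurable] g(1)] by simp
  have "indep_var borel Y borel ?g"
    unfolding indep_var_eq
  proof (intro conjI)
    show "random_variable borel Y" by (rule measurable_past_imp[OF Y(1)])
    show "random_variable borel ?g" by (rule gm)
    show "indep_set (sigma_sets (space M) {Y -` A \<inter> space M | A. A \<in> sets borel})
        (sigma_sets (space M) {?g -` A \<inter> space M | A. A \<in> sets borel})"
    proof (rule indep_set_sigma_sets)
      show "indep_set {Y -` A \<inter> space M | A. A \<in> sets borel} {?g -` A \<inter> space M | A. A \<in> sets borel}"
        unfolding indep_sets2_eq
      proof (intro conjI ballI)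
        show "{Y -` A \<inter> space M | A. A \<in> sets borel} \<subseteq> events"
          using measurable_past_imp[OF Y(1)] by (auto intro: measurable_sets)
        show "{?g -` A \<inter> space M | A. A \<in> sets borel} \<subseteq> events"
          using gm by (auto intro: measurable_sets)
        fix a b assume "a \<in> {Y -` A \<inter> space M | A. A \<in> sets borel}"
          and "b \<in> {?g -` A \<inter> space M | A. A \<in> sets borel}"
        then obtain A B where AB: "A \<in> sets borel" "B \<in> sets borel"
          "a = Y -` A \<inter> space M" "b = ?g -` B \<inter> space M" by auto
        let ?B = "(\<lambda>(d, x). g d x) -` B"
        have a: "a \<in> sets (past n)" using measurable_sets[OF Y(1) AB(1)] AB(3) by simp
        have B: "?B \<in> sets (borel \<Otimes>\<^sub>M borel)"
          using measurable_sets[OF g(1) AB(2)] by (simp add: space_pair_measure)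
        have "b = {\<omega> \<in> space M. (\<delta> n \<omega>, \<xi> n \<omega>) \<in> ?B}" using AB(4) by auto
        then show "prob (a \<inter> b) = prob a * prob b"
          using present_independent_of_past[OF a B] by simp
      qed
    qed (rule Int_stable_vimage_sets)+
  qed
  from indep_var_integrable[OF this Y(2) g(2)] indep_var_lebesgue_integral[OF this Y(2) g(2)]
  show "integrable M (\<lambda>\<omega>. Y \<omega> * ?g \<omega>)"
    "expectation (\<lambda>\<omega>. Y \<omega> * ?g \<omega>) = expectation Y * expectation ?g"
    by simp_all
qed

end

section \<open>Moments of the jump chain\<close>

locale rhmc_test_process = rhmc_dynamics \<Phi> \<theta> lam \<phi> f C + rhmc_process M lam \<phi> \<theta> z \<delta> \<xi> Z
  for \<Phi> :: "real ^ 'd::finite \<Rightarrow> real" and \<theta> :: "real \<Rightarrow> 'd phase \<Rightarrow> 'd phase"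
    and lam \<phi> :: real and f :: "'d phase \<Rightarrow> real" and C :: real
    and M :: "'w measure" and z :: "'d phase"
    and \<delta> :: "nat \<Rightarrow> 'w \<Rightarrow> real" and \<xi> :: "nat \<Rightarrow> 'w \<Rightarrow> real ^ 'd"
    and Z :: "real \<Rightarrow> 'w \<Rightarrow> 'd phase"
begin

definition T :: "nat \<Rightarrow> 'w \<Rightarrow> real" where
  "T n \<omega> = jump_time (\<lambda>k. \<delta> k \<omega>) n"

definition S :: "nat \<Rightarrow> 'w \<Rightarrow> 'd phase" where
  "S n \<omega> = skeleton \<phi> \<theta> z (\<lambda>k. \<delta> k \<omega>) (\<lambda>k. \<xi> k \<omega>) n"

definition jump_term :: "real \<Rightarrow> nat \<Rightarrow> 'w \<Rightarrow> real" where
  "jump_term t n \<omega> = compensated_jump t (S n \<omega>) (T n \<omega>) (\<delta> n \<omega>) (\<xi> n \<omega>)"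

lemma T_0 [simp]: "T 0 \<omega> = 0"
  by (simp add: T_def jump_time_def)

lemma T_Suc [simp]: "T (Suc n) \<omega> = T n \<omega> + \<delta> n \<omega>"
  by (simp add: T_def jump_time_def)

lemma S_0 [simp]: "S 0 \<omega> = z"
  by (simp add: S_def)

lemma S_Suc [simp]: "S (Suc n) \<omega> = momentum_refresh \<phi> (\<theta> (\<delta> n \<omega>) (S n \<omega>)) (\<xi> n \<omega>)"
  by (simp add: S_def)

lemma rate_pos: "1 / lam > 0"
  using lam_pos by simp

lemma T_past: "T n \<in> borel_measurable (past n)"
  unfolding T_def[abs_def] by (rule jump_time_past)

lemma S_past: "S n \<in> borel_measurable (past n)"
proof (induction n)
  case 0
  have "S 0 = (\<lambda>_. z)" by (simp add: fun_eq_iff)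
  then show ?case by simp
next
  case (Suc n)
  have [measurable]: "S n \<in> borel_measurable (past (Suc n))"
    by (rule measurable_past_mono[OF Suc.IH]) simp
  have [measurable]: "\<delta> n \<in> borel_measurable (past (Suc n))" "\<xi> n \<in> borel_measurable (past (Suc n))"
    by (simp_all add: waiting_time_past gaussian_past)
  have "S (Suc n) = (\<lambda>\<omega>. momentum_refresh \<phi> (\<theta> (\<delta> n \<omega>) (S n \<omega>)) (\<xi> n \<omega>))"
    by (simp add: fun_eq_iff)
  then show ?case by simp
qed

lemma T_measurable [measurable]: "T n \<in> borel_measurable M"
  by (rule measurable_past_imp[OF T_past])

lemma S_measurable [measurable]: "S n \<in> borel_measurable M"
  by (rule measurable_past_imp[OF S_past])

lemma jump_term_measurable [measurable]: "jump_term t n \<in> borel_measurable M"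
  unfolding jump_term_def[abs_def]
  using measurable_compose[OF measurable_Pair[OF S_measurable[of n] measurable_Pair[OF T_measurable[of n]
        measurable_Pair[OF waiting_time_measurable[of n] gaussian_measurable[of n]]]] compensated_jump_measurable]
  by simp

lemma AE_waiting_time_pos: "AE \<omega> in M. \<forall>n. 0 < \<delta> n \<omega>"
proof -
  have "AE \<omega> in M. 0 < \<delta> n \<omega>" for n
  proof -
    have "prob {\<omega> \<in> space M. 0 < \<delta> n \<omega>} = 1"
      using exponential_distributedD_gt[OF waiting_times[of n] order_refl rate_pos] by simp
    then show ?thesis by (subst (asm) prob_Collect_eq_1) auto
  qed
  then show ?thesis by (simp add: AE_all_countable)
qed

lemma integrable_gaussian_norm: "integrable M (\<lambda>\<omega>. norm (\<xi> n \<omega>))"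
  and expectation_gaussian_norm: "expectation (\<lambda>\<omega>. norm (\<xi> n \<omega>)) = mean_gaussian_norm TYPE('d)"
proof -
  show "integrable M (\<lambda>\<omega>. norm (\<xi> n \<omega>))"
    using integrable_norm_std_gaussian[where 'd = 'd] unfolding gaussians[of n, symmetric]
    by (subst (asm) integrable_distr_eq) auto
  show "expectation (\<lambda>\<omega>. norm (\<xi> n \<omega>)) = mean_gaussian_norm TYPE('d)"
    unfolding gaussians[of n, symmetric] by (subst integral_distr) auto
qed

text \<open>The Laplace transform of a waiting time at 1. Being less than 1, it makes \<open>\<E>[exp (- T\<^sub>n)]\<close> decay
  geometrically, which replaces a tail estimate for the number of jumps before \<open>t\<close>.\<close>

definition discount :: real where
  "discount = (\<integral>x. exp (- x) \<partial>waiting_law)"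

lemma integrable_exp_waiting_time: "integrable M (\<lambda>\<omega>. exp (- \<delta> n \<omega>))"
  and expectation_exp_waiting_time: "expectation (\<lambda>\<omega>. exp (- \<delta> n \<omega>)) = discount"
proof -
  show "integrable M (\<lambda>\<omega>. exp (- \<delta> n \<omega>))"
  proof (rule integrable_const_bound)
    show "AE \<omega> in M. norm (exp (- \<delta> n \<omega>)) \<le> 1"
      using AE_waiting_time_pos by eventually_elim (auto intro: less_imp_le)
  qed measurable
  show "expectation (\<lambda>\<omega>. exp (- \<delta> n \<omega>)) = discount"
    unfolding discount_def distributed_distr_eq_density[OF waiting_times[of n], symmetric]
    by (subst integral_distr) auto
qed

lemma discount_nonneg: "0 \<le> discount"
  unfolding discount_def by (rule Bochner_Integration.integral_nonneg) simp

lemma discount_less_1: "discount < 1"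
proof -
  have "expectation (\<lambda>\<omega>. exp (- \<delta> 0 \<omega>)) < 1"
  proof (rule expectation_less)
    show "AE \<omega> in M. exp (- \<delta> 0 \<omega>) < 1" using AE_waiting_time_pos by eventually_elim simp
  qed (rule integrable_exp_waiting_time)
  then show ?thesis by (simp add: expectation_exp_waiting_time)
qed

lemma integrable_discounted_gaussian: "integrable M (\<lambda>\<omega>. exp (- \<delta> n \<omega>) * norm (\<xi> n \<omega>))"
  and expectation_discounted_gaussian_le:
    "expectation (\<lambda>\<omega>. exp (- \<delta> n \<omega>) * norm (\<xi> n \<omega>)) \<le> mean_gaussian_norm TYPE('d)"
proof -
  have le: "AE \<omega> in M. exp (- \<delta> n \<omega>) * norm (\<xi> n \<omega>) \<le> norm (\<xi> n \<omega>)"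
    using AE_waiting_time_pos by eventually_elim (rule mult_left_le_one_le; simp add: less_imp_le)
  then show 1: "integrable M (\<lambda>\<omega>. exp (- \<delta> n \<omega>) * norm (\<xi> n \<omega>))"
    by (intro Bochner_Integration.integrable_bound[OF integrable_gaussian_norm[of n]]) auto
  show "expectation (\<lambda>\<omega>. exp (- \<delta> n \<omega>) * norm (\<xi> n \<omega>)) \<le> mean_gaussian_norm TYPE('d)"
    unfolding expectation_gaussian_norm[of n, symmetric]
    by (rule integral_mono_AE[OF 1 integrable_gaussian_norm le])
qed

lemma
  shows integrable_exp_T: "integrable M (\<lambda>\<omega>. exp (- T n \<omega>))"
    and expectation_exp_T: "expectation (\<lambda>\<omega>. exp (- T n \<omega>)) = discount ^ n"
proof (induction n)
  case 0
  {
    case 1 show ?case by simp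
  next
    case 2 show ?case by (simp add: prob_space)
  }
next
  case (Suc n)
  have eq: "(\<lambda>\<omega>. exp (- T (Suc n) \<omega>)) = (\<lambda>\<omega>. exp (- T n \<omega>) * exp (- \<delta> n \<omega>))"
    by (simp add: exp_add[symmetric])
  have "(\<lambda>\<omega>. exp (- T n \<omega>)) \<in> borel_measurable (past n)"
    using T_past[of n] by measurable
  note prod = integrable_past_times_present[OF this Suc(1), of "\<lambda>d x. exp (- d)"]
    expectation_past_times_present[OF this Suc(1), of "\<lambda>d x. exp (- d)"]
  {
    case 1 show ?case unfolding eq using prod(1) integrable_exp_waiting_time by simp
  next
    case 2 show ?case unfolding eq
      using prod(2) integrable_exp_waiting_time Suc(2) by (simp add: expectation_exp_waiting_time)
  }
qed

text \<open>Splitting off the last noise turns the expectation \<open>v\<^sub>n\<close> into the recursion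
  \<open>v\<^bsub>n+1\<^esub> \<le> \<rho> v\<^sub>n + m \<rho>\<^sup>n\<close> with \<open>\<rho> = discount\<close>, solved by \<open>m n \<rho>\<^bsup>n-1\<^esup>\<close>; the factor \<open>n\<close> makes the truncated
  exponent at \<open>n = 0\<close> harmless.\<close>

lemma
  shows integrable_discounted_sum: "integrable M (\<lambda>\<omega>. exp (- T n \<omega>) * (\<Sum>j<n. norm (\<xi> j \<omega>)))"
    and expectation_discounted_sum_le:
      "expectation (\<lambda>\<omega>. exp (- T n \<omega>) * (\<Sum>j<n. norm (\<xi> j \<omega>)))
        \<le> mean_gaussian_norm TYPE('d) * (real n * discount ^ (n - 1))"
proof (induction n)
  case 0
  {
    case 1 show ?case by simp
  next
    case 2 show ?case by simp
  }
next
  case (Suc n)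
  let ?U = "\<lambda>\<omega>. exp (- T n \<omega>)" and ?V = "\<lambda>\<omega>. exp (- T n \<omega>) * (\<Sum>j<n. norm (\<xi> j \<omega>))"
  let ?m = "mean_gaussian_norm TYPE('d)"
  have eq: "(\<lambda>\<omega>. exp (- T (Suc n) \<omega>) * (\<Sum>j<Suc n. norm (\<xi> j \<omega>)))
      = (\<lambda>\<omega>. ?V \<omega> * exp (- \<delta> n \<omega>) + ?U \<omega> * (exp (- \<delta> n \<omega>) * norm (\<xi> n \<omega>)))"
    by (simp add: exp_diff exp_minus field_simps)
  have U: "?U \<in> borel_measurable (past n)" using T_past[of n] by measurable
  have V: "?V \<in> borel_measurable (past n)"
    by (intro borel_measurable_times U borel_measurable_sum
        measurable_compose[OF gaussian_past borel_measurable_norm]) simp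
  have m1: "(\<lambda>(d :: real, x :: real ^ 'd). exp (- d)) \<in> borel_measurable (borel \<Otimes>\<^sub>M borel)"
    by measurable
  have m2: "(\<lambda>(d :: real, x :: real ^ 'd). exp (- d) * norm x) \<in> borel_measurable (borel \<Otimes>\<^sub>M borel)"
    by measurable
  note int1 = integrable_past_times_present[OF V Suc(1) m1 integrable_exp_waiting_time]
    and int2 = integrable_past_times_present[OF U integrable_exp_T m2 integrable_discounted_gaussian]
  {
    case 1 show ?case unfolding eq by (rule Bochner_Integration.integrable_add[OF int1 int2])
  next
    case 2
    have "expectation (\<lambda>\<omega>. exp (- T (Suc n) \<omega>) * (\<Sum>j<Suc n. norm (\<xi> j \<omega>)))
        = expectation ?V * discount
          + discount ^ n * expectation (\<lambda>\<omega>. exp (- \<delta> n \<omega>) * norm (\<xi> n \<omega>))"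
      unfolding eq Bochner_Integration.integral_add[OF int1 int2]
        expectation_past_times_present[OF V Suc(1) m1 integrable_exp_waiting_time]
        expectation_past_times_present[OF U integrable_exp_T m2 integrable_discounted_gaussian]
        expectation_exp_T expectation_exp_waiting_time by simp
    also have "\<dots> \<le> ?m * (real n * discount ^ (n - 1)) * discount + discount ^ n * ?m"
      using Suc(2) discount_nonneg expectation_discounted_gaussian_le
      by (intro add_mono mult_right_mono mult_left_mono) auto
    also have "\<dots> = ?m * (real (Suc n) * discount ^ (Suc n - 1))"
      by (cases n) (simp_all add: algebra_simps)
    finally show ?case .
  }
qed

lemma summable_linear_times_discount_power:
  "summable (\<lambda>n. real n * discount ^ (n - 1))"
proof -
  have "summable (\<lambda>n. real (Suc n) * discount ^ n)"
    using geometric_deriv_sums[of discount] discount_nonneg discount_less_1 by (auto simp: sums_iff)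
  then have "summable (\<lambda>n. real (Suc n) * discount ^ (Suc n - 1))" by simp
  then show ?thesis by (subst (asm) summable_Suc_iff)
qed

lemma summable_discount_power: "summable (\<lambda>n. discount ^ n)"
  using discount_nonneg discount_less_1 by (intro summable_geometric) simp

text \<open>The expectations of \<open>exp (- T\<^sub>n)\<close> are summable, so almost surely \<open>exp (- T\<^sub>n)\<close> tends to 0: jumps do not
  accumulate.\<close>

lemma AE_jump_times_unbounded: "AE \<omega> in M. \<forall>t. \<exists>n. t < T n \<omega>"
proof -
  have "(\<integral>\<^sup>+\<omega>. (\<Sum>n. ennreal (exp (- T n \<omega>))) \<partial>M) = (\<Sum>n. ennreal (discount ^ n))"
    by (subst nn_integral_suminf)
       (auto simp: nn_integral_eq_integral[OF integrable_exp_T] expectation_exp_T)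
  also have "\<dots> = ennreal (\<Sum>n. discount ^ n)"
    using discount_nonneg by (intro suminf_ennreal2 summable_discount_power) auto
  finally have "(\<integral>\<^sup>+\<omega>. (\<Sum>n. ennreal (exp (- T n \<omega>))) \<partial>M) \<noteq> \<infinity>" by simp
  then have "AE \<omega> in M. (\<Sum>n. ennreal (exp (- T n \<omega>))) \<noteq> \<infinity>"
    by (intro nn_integral_PInf_AE) auto
  then show ?thesis
  proof eventually_elim
    case (elim \<omega>)
    then have "summable (\<lambda>n. exp (- T n \<omega>))"
      by (intro summable_suminf_not_top) auto
    then have lim: "(\<lambda>n. exp (- T n \<omega>)) \<longlonglongrightarrow> 0" by (rule summable_LIMSEQ_zero)
    show ?case
    proof
      fix t
      from order_tendstoD(2)[OF lim, of "exp (- t)"] obtain n where "exp (- T n \<omega>) < exp (- t)"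
        unfolding eventually_sequentially by auto
      then show "\<exists>n. t < T n \<omega>" by auto
    qed
  qed
qed

lemma energy_radius_S_le: "energy_radius \<Phi> (S n \<omega>) \<le> energy_radius \<Phi> z + (\<Sum>j<n. norm (\<xi> j \<omega>))"
proof (induction n)
  case (Suc n)
  have "energy_radius \<Phi> (S (Suc n) \<omega>) \<le> energy_radius \<Phi> (S n \<omega>) + norm (\<xi> n \<omega>)"
    using energy_radius_refresh[of "\<theta> (\<delta> n \<omega>) (S n \<omega>)" "\<xi> n \<omega>"] by (simp add: energy_radius_flow)
  with Suc show ?case by simp
qed simp

text \<open>The three moments \<open>U\<close>, \<open>V\<close>, \<open>W\<close> in the proof are discounted by \<open>exp (- T\<^sub>n)\<close>: after multiplication by \<open>exp t\<close>
  the discount dominates the indicator of \<open>T\<^sub>n \<le> t\<close> and, unlike the indicator, factorizes over the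
  independent waiting times.\<close>

lemma
  assumes t: "0 \<le> t"
  shows integrable_jump_term: "integrable M (jump_term t n)"
    and summable_expectation_jump_term: "summable (\<lambda>n. expectation (\<lambda>\<omega>. \<bar>jump_term t n \<omega>\<bar>))"
proof -
  let ?m = "mean_gaussian_norm TYPE('d)"
  \<comment> \<open>\<open>a\<close>, \<open>b\<close> and \<open>C\<close> collect the coefficients of \<open>1\<close>, \<open>|\<xi>\<^sub>0| + \<dots> + |\<xi>\<^bsub>n-1\<^esub>|\<close> and \<open>|\<xi>\<^sub>n|\<close>
    in the bound on a compensated jump.\<close>
  define a where "a = C * (2 * energy_radius \<Phi> z) + t / lam * (C * (2 * energy_radius \<Phi> z + ?m))"
  define b where "b = 2 * C * (1 + t / lam)"
  have nonneg: "0 \<le> a" "0 \<le> b"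
    unfolding a_def b_def using t lam_pos C_nonneg energy_radius_nonneg[of z] mean_gaussian_norm_nonneg
    by simp_all
  define U where "U n \<omega> = exp (- T n \<omega>)" for n \<omega>
  define V where "V n \<omega> = exp (- T n \<omega>) * (\<Sum>j<n. norm (\<xi> j \<omega>))" for n \<omega>
  define W where "W n \<omega> = exp (- T n \<omega>) * norm (\<xi> n \<omega>)" for n \<omega>
  have Um: "U n \<in> borel_measurable (past n)" for n
    unfolding U_def[abs_def] using T_past[of n] by measurable
  have mx: "(\<lambda>(d :: real, x :: real ^ 'd). norm x) \<in> borel_measurable (borel \<Otimes>\<^sub>M borel)" by measurable
  have U: "integrable M (U n)" "expectation (U n) = discount ^ n" for n
    unfolding U_def[abs_def] by (fact integrable_exp_T, fact expectation_exp_T)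
  have V: "integrable M (V n)" "expectation (V n) \<le> ?m * (real n * discount ^ (n - 1))" for n
    unfolding V_def[abs_def] by (fact integrable_discounted_sum, fact expectation_discounted_sum_le)
  have W: "integrable M (W n)" "expectation (W n) = discount ^ n * ?m" for n
    using integrable_past_times_present[OF Um U(1) mx integrable_gaussian_norm]
      expectation_past_times_present[OF Um U(1) mx integrable_gaussian_norm]
    unfolding W_def[abs_def] U_def U(2) expectation_gaussian_norm by simp_all
  let ?G = "\<lambda>n \<omega>. exp t * (a * U n \<omega> + b * V n \<omega> + C * W n \<omega>)"
  have G: "integrable M (?G n)"
    "expectation (?G n) = exp t * (a * expectation (U n) + b * expectation (V n) + C * expectation (W n))" for n
    using U(1)[of n] V(1)[of n] W(1)[of n] by simp_all
  have bound: "AE \<omega> in M. \<bar>jump_term t n \<omega>\<bar> \<le> ?G n \<omega>" for n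
    using AE_waiting_time_pos
  proof eventually_elim
    case (elim \<omega>)
    have T0: "0 \<le> T n \<omega>"
      unfolding T_def jump_time_def using elim by (intro sum_nonneg) (simp add: less_imp_le)
    let ?s = "\<Sum>j<n. norm (\<xi> j \<omega>)" and ?E = "energy_radius \<Phi> (S n \<omega>)"
    let ?B = "C * (2 * ?E + norm (\<xi> n \<omega>)) + (t - T n \<omega>) / lam * (C * (2 * ?E + ?m))"
    have jump: "\<bar>jump_term t n \<omega>\<bar> \<le> indicator {..t} (T n \<omega>) * ?B"
      unfolding jump_term_def by (rule compensated_jump_bound) (simp add: elim less_imp_le)
    have G_eq: "?G n \<omega> = exp (t - T n \<omega>) * (a + b * ?s + C * norm (\<xi> n \<omega>))"
      by (simp add: U_def V_def W_def exp_diff exp_minus field_simps)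
    have nn: "0 \<le> a + b * ?s + C * norm (\<xi> n \<omega>)"
      using nonneg C_nonneg by (intro add_nonneg_nonneg mult_nonneg_nonneg sum_nonneg) auto
    show ?case
    proof (cases "T n \<omega> \<le> t")
      case True
      have "?B \<le> C * (2 * (energy_radius \<Phi> z + ?s) + norm (\<xi> n \<omega>))
          + t / lam * (C * (2 * (energy_radius \<Phi> z + ?s) + ?m))"
        using T0 True t lam_pos C_nonneg energy_radius_S_le[of n \<omega>] energy_radius_nonneg
          mean_gaussian_norm_nonneg
        by (intro add_mono mult_mono mult_left_mono divide_right_mono mult_nonneg_nonneg add_nonneg_nonneg) auto
      also have "\<dots> = a + b * ?s + C * norm (\<xi> n \<omega>)"
        by (simp add: a_def b_def algebra_simps)
      also have "\<dots> \<le> exp (t - T n \<omega>) * (a + b * ?s + C * norm (\<xi> n \<omega>))"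
        using nn True by (intro mult_le_cancel_right1[THEN iffD2]) (auto simp: not_less)
      finally show ?thesis using jump True unfolding G_eq by simp
    next
      case False
      then show ?thesis using jump nn unfolding G_eq by simp
    qed
  qed
  show int: "integrable M (jump_term t n)" for n
    by (rule Bochner_Integration.integrable_bound[OF G(1)[of n]])
       (measurable, use bound[of n] in eventually_elim, simp)
  show "summable (\<lambda>n. expectation (\<lambda>\<omega>. \<bar>jump_term t n \<omega>\<bar>))"
  proof (rule summable_comparison_test')
    show "summable (\<lambda>n. exp t * (a * discount ^ n + b * (?m * (real n * discount ^ (n - 1)))
        + C * (discount ^ n * ?m)))"
      by (intro summable_mult summable_add summable_mult2 summable_discount_power
          summable_linear_times_discount_power)
    fix n :: nat
    have "expectation (\<lambda>\<omega>. \<bar>jump_term t n \<omega>\<bar>) \<le> expectation (?G n)"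
      by (intro integral_mono_AE integrable_abs int G(1) bound)
    also have "\<dots> \<le> exp t * (a * discount ^ n + b * (?m * (real n * discount ^ (n - 1)))
        + C * (discount ^ n * ?m))"
      unfolding G(2) U(2) W(2) using V(2)[of n] nonneg
      by (intro mult_left_mono add_mono order_refl) auto
    finally show "norm (expectation (\<lambda>\<omega>. \<bar>jump_term t n \<omega>\<bar>))
        \<le> exp t * (a * discount ^ n + b * (?m * (real n * discount ^ (n - 1))) + C * (discount ^ n * ?m))"
      by simp
  qed
qed

text \<open>Given the past, the state and the time at the start of the segment are constants, so the
  vanishing mean of a single compensated jump applies under the outer integral.\<close>

lemma jump_term_orthogonal_to_past:
  assumes t: "0 \<le> t" and A: "A \<in> sets (past n)"
  shows "expectation (\<lambda>\<omega>. indicator A \<omega> * jump_term t n \<omega>) = 0"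
proof -
  let ?N = "borel \<Otimes>\<^sub>M borel \<Otimes>\<^sub>M borel :: (real \<times> 'd phase \<times> real) measure"
  let ?Y = "\<lambda>\<omega>. (indicator A \<omega> :: real, S n \<omega>, T n \<omega>)"
  let ?P = "waiting_law \<Otimes>\<^sub>M (std_gaussian :: (real ^ 'd) measure)"
  let ?F = "\<lambda>((c, y, \<tau>), d, x). c * compensated_jump t y \<tau> d x"
  let ?X = "\<lambda>\<omega>. (?Y \<omega>, \<delta> n \<omega>, \<xi> n \<omega>)"
  have Y: "?Y \<in> past n \<rightarrow>\<^sub>M ?N"
    by (intro measurable_Pair borel_measurable_indicator A S_past T_past)
  have Ym [measurable]: "?Y \<in> M \<rightarrow>\<^sub>M ?N" by (rule measurable_past_imp[OF Y])
  note law = past_present_law[OF rate_pos Y]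
  have Fm [measurable]: "?F \<in> borel_measurable (?N \<Otimes>\<^sub>M (borel \<Otimes>\<^sub>M borel))"
  proof -
    have "(\<lambda>p. (fst (snd (fst p)), snd (snd (fst p)), fst (snd p), snd (snd p)))
        \<in> (?N \<Otimes>\<^sub>M (borel \<Otimes>\<^sub>M borel)) \<rightarrow>\<^sub>M (borel \<Otimes>\<^sub>M borel \<Otimes>\<^sub>M borel \<Otimes>\<^sub>M borel)"
      by measurable
    from measurable_compose[OF this compensated_jump_measurable[of t]]
    have [measurable]: "(\<lambda>p. compensated_jump t (fst (snd (fst p))) (snd (snd (fst p))) (fst (snd p)) (snd (snd p)))
        \<in> borel_measurable (?N \<Otimes>\<^sub>M (borel \<Otimes>\<^sub>M borel))" by (simp only: prod.case)
    show ?thesis unfolding split_beta' by measurable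
  qed
  have Xm [measurable]: "?X \<in> M \<rightarrow>\<^sub>M (?N \<Otimes>\<^sub>M (borel \<Otimes>\<^sub>M borel))" by measurable
  interpret Y: prob_space "distr M ?N ?Y" by (rule prob_space_distr) (rule Ym)
  interpret P: prob_space ?P
    unfolding present_law[OF rate_pos, of 0, symmetric] by (rule prob_space_distr) measurable
  interpret YP: pair_sigma_finite "distr M ?N ?Y" ?P ..
  have A': "A \<in> sets M" using A past_subalgebra by (auto simp: subalgebra_def)
  have "integrable M (\<lambda>\<omega>. ?F (?X \<omega>))"
    using integrable_real_mult_indicator[OF A' integrable_jump_term[OF t, of n]]
    by (simp add: jump_term_def mult.commute)
  then have "integrable (distr M (?N \<Otimes>\<^sub>M (borel \<Otimes>\<^sub>M borel)) ?X) ?F"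
    by (subst integrable_distr_eq) auto
  then have int: "integrable (distr M ?N ?Y \<Otimes>\<^sub>M ?P) ?F" unfolding law .
  have "expectation (\<lambda>\<omega>. indicator A \<omega> * jump_term t n \<omega>) = (\<integral>p. ?F p \<partial>distr M (?N \<Otimes>\<^sub>M (borel \<Otimes>\<^sub>M borel)) ?X)"
    by (subst integral_distr) (auto simp: jump_term_def)
  also have "\<dots> = (\<integral>u. (\<integral>v. ?F (u, v) \<partial>?P) \<partial>distr M ?N ?Y)"
    unfolding law by (rule YP.integral_fst'[OF int, symmetric])
  also have "\<dots> = (\<integral>u. 0 \<partial>distr M ?N ?Y)"
  proof (rule Bochner_Integration.integral_cong[OF refl])
    fix u :: "real \<times> 'd phase \<times> real"
    obtain c y \<tau> where u: "u = (c, y, \<tau>)" by (cases u)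
    have "(\<integral>v. ?F (u, v) \<partial>?P) = (\<integral>v. c * (case v of (d, x) \<Rightarrow> compensated_jump t y \<tau> d x) \<partial>?P)"
      by (simp add: u split_beta')
    also have "\<dots> = c * (\<integral>(d, x). compensated_jump t y \<tau> d x \<partial>?P)"
      by (rule integral_mult_right_zero)
    also have "\<dots> = 0" by (simp only: compensated_jump_mean_zero(2) mult_zero_right)
    finally show "(\<integral>v. ?F (u, v) \<partial>?P) = 0" .
  qed
  finally show ?thesis by simp
qed

section \<open>Path decomposition of the compensated process\<close>

text \<open>Almost every path is regular (\<open>AE_regular\<close>); on such paths the jump times increase to infinity and the
  piecewise description of the path holds at all times, so pathwise identities can be proved.\<close>

definition regular :: "'w \<Rightarrow> bool" where
  "regular \<omega> \<longleftrightarrow> (\<forall>n. 0 < \<delta> n \<omega>) \<and> (\<forall>t. \<exists>n. t < T n \<omega>) \<and>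
     (\<forall>n s. T n \<omega> \<le> s \<and> s < T (Suc n) \<omega> \<longrightarrow> Z s \<omega> = \<theta> (s - T n \<omega>) (S n \<omega>))"

definition M_f :: "real \<Rightarrow> 'w \<Rightarrow> real" where
  "M_f t \<omega> = f (Z t \<omega>) - f z - (LBINT s:{0..t}. rhmc_generator lam \<phi> \<Phi> f (Z s \<omega>))"

lemma AE_regular: "AE \<omega> in M. regular \<omega>"
  using AE_waiting_time_pos AE_jump_times_unbounded Z_path
proof eventually_elim
  case (elim \<omega>)
  then show ?case unfolding regular_def T_def S_def by blast
qed

lemma regular_T_mono:
  assumes "regular \<omega>" "m \<le> n"
  shows "T m \<omega> \<le> T n \<omega>"
proof (rule lift_Suc_mono_le[OF _ assms(2)])
  show "T k \<omega> \<le> T (Suc k) \<omega>" for k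
    using assms(1) by (simp add: regular_def less_imp_le)
qed

lemma regular_jump_interval:
  assumes "regular \<omega>" "0 \<le> t"
  obtains n where "T n \<omega> \<le> t" "t < T (Suc n) \<omega>"
proof -
  define N where "N = (LEAST m. t < T m \<omega>)"
  from assms(1) have "\<exists>m. t < T m \<omega>" by (simp add: regular_def)
  then have N: "t < T N \<omega>" unfolding N_def by (rule LeastI_ex)
  moreover have "N \<noteq> 0" using N assms(2) by (metis T_0 not_le)
  then obtain n where "N = Suc n" by (cases N) auto
  moreover have "\<not> t < T n \<omega>"
    using not_less_Least[of n "\<lambda>m. t < T m \<omega>"] \<open>N = Suc n\<close> unfolding N_def[symmetric] by simp
  ultimately show ?thesis using that[of n] by simp
qed

lemma jump_term_eq_0:
  assumes "regular \<omega>" "t < T k \<omega>"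
  shows "jump_term t k \<omega> = 0"
proof -
  have "0 \<le> \<delta> k \<omega>" using assms(1) by (simp add: regular_def less_imp_le)
  from compensated_jump_bound[OF this, of t "S k \<omega>" "T k \<omega>" "\<xi> k \<omega>"] show ?thesis
    using assms(2) by (simp add: jump_term_def)
qed

text \<open>At each time exactly one segment is active. Translating each segment to start at 0 gives the integrals
  that occur in \<open>compensated_jump_eq_generator\<close>.\<close>

lemma generator_integral_eq_sum_over_segments:
  assumes reg: "regular \<omega>" and n: "T n \<omega> \<le> t" "t < T (Suc n) \<omega>"
  shows "(LBINT s:{0..t}. rhmc_generator lam \<phi> \<Phi> f (Z s \<omega>)) =
    (\<Sum>k<Suc n. \<integral>r. indicator {0..<\<delta> k \<omega>} r *
       (indicator {..t} (T k \<omega> + r) * rhmc_generator lam \<phi> \<Phi> f (\<theta> r (S k \<omega>))) \<partial>lborel)"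
proof -
  let ?L = "rhmc_generator lam \<phi> \<Phi> f"
  define h where "h k r = indicator {0..<\<delta> k \<omega>} r * (indicator {..t} (T k \<omega> + r) * ?L (\<theta> r (S k \<omega>)))"
    for k r
  have h_int: "integrable lborel (h k)" if "k < Suc n" for k
  proof -
    have "T k \<omega> \<le> t" using regular_T_mono[OF reg, of k n] that n by simp
    moreover have "0 \<le> \<delta> k \<omega>" using reg by (simp add: regular_def less_imp_le)
    ultimately show ?thesis
      unfolding h_def[abs_def] by (intro compensated_jump_eq_generator(1))
  qed
  have sum_ind: "(\<Sum>k<m. indicator {T k \<omega>..<T (Suc k) \<omega>} s) = (indicator {0..<T m \<omega>} s :: real)" for m s
  proof (induction m)
    case (Suc m)
    have "0 \<le> T m \<omega>" "T m \<omega> \<le> T (Suc m) \<omega>"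
      using regular_T_mono[OF reg, of 0 m] regular_T_mono[OF reg, of m "Suc m"] by simp_all
    with Suc show ?case by (auto simp: indicator_def)
  qed simp
  have shift: "h k (- T k \<omega> + 1 * s) = indicator {T k \<omega>..<T (Suc k) \<omega>} s * (indicator {..t} s * ?L (Z s \<omega>))" for k s
  proof (cases "T k \<omega> \<le> s \<and> s < T (Suc k) \<omega>")
    case True
    with reg have "Z s \<omega> = \<theta> (s - T k \<omega>) (S k \<omega>)" unfolding regular_def by blast
    with True show ?thesis by (simp add: h_def indicator_def)
  qed (auto simp: h_def indicator_def)
  have "indicator {0..t} s *\<^sub>R ?L (Z s \<omega>) = (\<Sum>k<Suc n. h k (- T k \<omega> + 1 * s))" for s
  proof -
    have "(\<Sum>k<Suc n. h k (- T k \<omega> + 1 * s))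
        = (\<Sum>k<Suc n. indicator {T k \<omega>..<T (Suc k) \<omega>} s) * (indicator {..t} s * ?L (Z s \<omega>))"
      unfolding shift sum_distrib_right ..
    also have "\<dots> = indicator {0..t} s *\<^sub>R ?L (Z s \<omega>)"
      unfolding sum_ind using n by (auto simp: indicator_def simp del: T_Suc)
    finally show ?thesis by simp
  qed
  then have "(LBINT s:{0..t}. ?L (Z s \<omega>)) = (\<integral>s. (\<Sum>k<Suc n. h k (- T k \<omega> + 1 * s)) \<partial>lborel)"
    unfolding set_lebesgue_integral_def by simp
  also have "\<dots> = (\<Sum>k<Suc n. \<integral>s. h k (- T k \<omega> + 1 * s) \<partial>lborel)"
    by (intro Bochner_Integration.integral_sum lborel_integrable_real_affine h_int) simp_all
  also have "\<dots> = (\<Sum>k<Suc n. \<integral>r. h k r \<partial>lborel)"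
  proof (rule sum.cong[OF refl])
    fix k
    show "(\<integral>s. h k (- T k \<omega> + 1 * s) \<partial>lborel) = (\<integral>r. h k r \<partial>lborel)"
      using lborel_integral_real_affine[of 1 "h k" "- T k \<omega>"] by simp
  qed
  finally show ?thesis unfolding h_def .
qed

text \<open>For a segment that is complete by time \<open>t\<close> the jump and the increment along the flow add up to
  \<open>f (S\<^bsub>k+1\<^esub>) - f (S\<^sub>k)\<close>; the running segment contributes \<open>f (Z\<^sub>t) - f (S\<^sub>n)\<close>. These differences telescope
  to \<open>f (Z\<^sub>t) - f z\<close>.\<close>

lemma M_f_eq_sum_jump_terms:
  assumes reg: "regular \<omega>" and n: "T n \<omega> \<le> t" "t < T (Suc n) \<omega>"
  shows "M_f t \<omega> = (\<Sum>k<Suc n. jump_term t k \<omega>)"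
proof -
  let ?I = "\<lambda>k. \<integral>r. indicator {0..<\<delta> k \<omega>} r *
       (indicator {..t} (T k \<omega> + r) * rhmc_generator lam \<phi> \<Phi> f (\<theta> r (S k \<omega>))) \<partial>lborel"
  have jump: "jump_term t k \<omega> = indicator {..t} (T k \<omega> + \<delta> k \<omega>) * (f (S (Suc k) \<omega>) - f (\<theta> (\<delta> k \<omega>) (S k \<omega>)))
      + (f (\<theta> (min (\<delta> k \<omega>) (t - T k \<omega>)) (S k \<omega>)) - f (S k \<omega>)) - ?I k" if "k \<le> n" for k
    unfolding jump_term_def S_Suc
    using regular_T_mono[OF reg that] n(1) reg
    by (intro compensated_jump_eq_generator(2)) (simp_all add: regular_def less_imp_le)
  have before: "jump_term t k \<omega> = f (S (Suc k) \<omega>) - f (S k \<omega>) - ?I k" if "k < n" for k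
  proof -
    have "T k \<omega> + \<delta> k \<omega> \<le> t" using regular_T_mono[OF reg, of "Suc k" n] that n(1) by simp
    then have "indicator {..t} (T k \<omega> + \<delta> k \<omega>) = (1 :: real)" "min (\<delta> k \<omega>) (t - T k \<omega>) = \<delta> k \<omega>" by simp_all
    with jump[of k] that show ?thesis by simp
  qed
  have last: "jump_term t n \<omega> = f (Z t \<omega>) - f (S n \<omega>) - ?I n"
  proof -
    have "Z t \<omega> = \<theta> (t - T n \<omega>) (S n \<omega>)" using reg n unfolding regular_def by blast
    moreover have "indicator {..t} (T n \<omega> + \<delta> n \<omega>) = (0 :: real)" "min (\<delta> n \<omega>) (t - T n \<omega>) = t - T n \<omega>"
      using n(2) by simp_all
    ultimately show ?thesis using jump[of n] by simp
  qed
  have "(\<Sum>k<Suc n. jump_term t k \<omega>) = (\<Sum>k<n. f (S (Suc k) \<omega>) - f (S k \<omega>) - ?I k) + (f (Z t \<omega>) - f (S n \<omega>) - ?I n)"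
    using before last by simp
  also have "\<dots> = (f (S n \<omega>) - f (S 0 \<omega>)) + (f (Z t \<omega>) - f (S n \<omega>)) - (\<Sum>k<Suc n. ?I k)"
    unfolding sum_subtractf[of "\<lambda>k. f (S (Suc k) \<omega>) - f (S k \<omega>)"]
      sum_lessThan_telescope[of "\<lambda>k. f (S k \<omega>)"] by simp
  also have "\<dots> = M_f t \<omega>"
    unfolding M_f_def generator_integral_eq_sum_over_segments[OF reg n] by simp
  finally show ?thesis ..
qed

lemma AE_jump_terms_sum_to_M_f:
  assumes t: "0 \<le> t"
  shows "AE \<omega> in M. (\<lambda>k. jump_term t k \<omega>) sums M_f t \<omega> \<and> summable (\<lambda>k. \<bar>jump_term t k \<omega>\<bar>)"
  using AE_regular
proof eventually_elim
  case (elim \<omega>)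
  obtain n where n: "T n \<omega> \<le> t" "t < T (Suc n) \<omega>" using regular_jump_interval[OF elim t] .
  have zero: "jump_term t k \<omega> = 0" if "k \<notin> {..<Suc n}" for k
  proof (rule jump_term_eq_0[OF elim])
    have "T (Suc n) \<omega> \<le> T k \<omega>" using that by (intro regular_T_mono elim) simp
    with n(2) show "t < T k \<omega>" by linarith
  qed
  have "(\<lambda>k. jump_term t k \<omega>) sums (\<Sum>k<Suc n. jump_term t k \<omega>)"
    by (rule sums_finite[OF finite_lessThan zero])
  moreover have "summable (\<lambda>k. \<bar>jump_term t k \<omega>\<bar>)"
    by (rule summable_finite[OF finite_lessThan[of "Suc n"]]) (subst zero, assumption, rule abs_zero)
  ultimately show ?case by (simp only: M_f_eq_sum_jump_terms[OF elim n])
qed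

end

section \<open>Adaptedness and the martingale property\<close>

lemma right_limit_along_sequence:
  fixes x :: "real \<Rightarrow> 'b::topological_space"
  assumes x: "(x \<longlongrightarrow> x c) (at_right c)" and a: "a \<longlonglongrightarrow> c" "\<And>n. c \<le> a n"
  shows "(\<lambda>n. x (a n)) \<longlonglongrightarrow> x c"
proof (rule topological_tendstoI)
  fix U assume U: "open U" "x c \<in> U"
  from topological_tendstoD[OF x U] obtain b where b: "c < b" "\<And>y. c < y \<Longrightarrow> y < b \<Longrightarrow> x y \<in> U"
    unfolding eventually_at_right_field by auto
  from order_tendstoD(2)[OF a(1) b(1)] show "\<forall>\<^sub>F n in sequentially. x (a n) \<in> U"
  proof eventually_elim
    case (elim n)
    then show ?case using a(2)[of n] b(2)[of "a n"] U(2) by (cases "a n = c") auto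
  qed
qed

text \<open>A right-continuous adapted process is jointly measurable on \<open>[0, t]\<close>: it is the limit of its
  discretizations at the next grid point to the right. Clipping to \<open>[0, t]\<close> keeps the
  discretizations measurable with respect to the information at time \<open>t\<close>.\<close>

lemma cadlag_time_integral_measurable:
  fixes X :: "real \<Rightarrow> 'w \<Rightarrow> 'b::metric_space" and g :: "'b \<Rightarrow> real"
  assumes t: "0 \<le> t"
    and X: "\<And>s. 0 \<le> s \<Longrightarrow> s \<le> t \<Longrightarrow> X s \<in> borel_measurable F"
    and cadlag: "\<And>\<omega>. \<omega> \<in> space F \<Longrightarrow> cadlag (\<lambda>s. X s \<omega>)"
    and g [measurable]: "g \<in> borel_measurable borel"
  shows "(\<lambda>\<omega>. LBINT s:{0..t}. g (X s \<omega>)) \<in> borel_measurable F"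
proof -
  let ?clip = "\<lambda>s. max 0 (min t s)"
  \<comment> \<open>The right end of the cell of the grid of width \<open>1 / (n + 1)\<close> that contains \<open>s\<close>; it lies strictly to the right of \<open>s\<close>.\<close>
  define up where "up n s = (of_int \<lfloor>real (Suc n) * s\<rfloor> + 1) / real (Suc n)" for n s
  have up_gt: "s < up n s" for n s
  proof -
    have "real (Suc n) * s < of_int \<lfloor>real (Suc n) * s\<rfloor> + 1" by linarith
    then show ?thesis by (simp add: up_def field_simps)
  qed
  have up_le: "up n s \<le> s + inverse (real (Suc n))" for n s
  proof -
    have "of_int \<lfloor>real (Suc n) * s\<rfloor> + 1 \<le> real (Suc n) * s + 1" by linarith
    then have "up n s \<le> (real (Suc n) * s + 1) / real (Suc n)"
      unfolding up_def by (rule divide_right_mono) simp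
    also have "\<dots> = s + inverse (real (Suc n))"
      by (simp add: add_divide_distrib inverse_eq_divide del: of_nat_Suc)
    finally show ?thesis .
  qed
  have up_lim: "(\<lambda>n. up n s) \<longlonglongrightarrow> s" for s
  proof (rule tendsto_sandwich[OF _ _ tendsto_const LIMSEQ_inverse_real_of_nat_add])
    show "\<forall>\<^sub>F n in sequentially. s \<le> up n s" using up_gt by (intro always_eventually allI less_imp_le)
    show "\<forall>\<^sub>F n in sequentially. up n s \<le> s + inverse (real (Suc n))"
      using up_le by (intro always_eventually allI)
  qed
  have "(\<lambda>p. X (?clip (snd p)) (fst p)) \<in> borel_measurable (F \<Otimes>\<^sub>M lborel)"
  proof (rule borel_measurable_LIMSEQ_metric)
    fix n
    \<comment> \<open>A discretization takes countably many time values, so it is enough to treat a fixed cell \<open>i\<close>.\<close>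
    let ?H = "\<lambda>(i :: int) p. X (?clip ((of_int i + 1) / real (Suc n))) (fst p)"
    have "(\<lambda>p. ?H \<lfloor>real (Suc n) * snd p\<rfloor> p) \<in> borel_measurable (F \<Otimes>\<^sub>M lborel)"
    proof (rule measurable_compose_countable[where f = ?H])
      show "?H i \<in> borel_measurable (F \<Otimes>\<^sub>M lborel)" for i
        by (rule measurable_compose[OF measurable_fst X]) (use t in auto)
      show "(\<lambda>p. \<lfloor>real (Suc n) * snd p\<rfloor>) \<in> F \<Otimes>\<^sub>M lborel \<rightarrow>\<^sub>M count_space UNIV" by measurable
    qed
    then show "(\<lambda>p. X (?clip (up n (snd p))) (fst p)) \<in> borel_measurable (F \<Otimes>\<^sub>M lborel)"
      by (simp only: up_def)
  next
    fix p :: "'w \<times> real" assume "p \<in> space (F \<Otimes>\<^sub>M lborel)"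
    then have "fst p \<in> space F" by (auto simp: space_pair_measure)
    then have right: "((\<lambda>s. X s (fst p)) \<longlongrightarrow> X c (fst p)) (at_right c)" if "0 \<le> c" for c
      using cadlag that unfolding cadlag_def by blast
    show "(\<lambda>n. X (?clip (up n (snd p))) (fst p)) \<longlonglongrightarrow> X (?clip (snd p)) (fst p)"
    proof (rule right_limit_along_sequence[OF right])
      show "(\<lambda>n. ?clip (up n (snd p))) \<longlonglongrightarrow> ?clip (snd p)"
        by (intro tendsto_max tendsto_min tendsto_const up_lim)
      show "?clip (snd p) \<le> ?clip (up n (snd p))" for n
        using up_gt[of "snd p" n] by (simp add: max_def min_def)
    qed simp
  qed
  then have [measurable]: "(\<lambda>p. X (?clip (snd p)) (fst p)) \<in> borel_measurable (F \<Otimes>\<^sub>M lborel)" .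
  have "(\<lambda>p. indicator {0..t} (snd p) *\<^sub>R g (X (?clip (snd p)) (fst p))) \<in> borel_measurable (F \<Otimes>\<^sub>M lborel)"
    by measurable
  then have "(\<lambda>\<omega>. \<integral>s. indicator {0..t} s *\<^sub>R g (X (?clip s) \<omega>) \<partial>lborel) \<in> borel_measurable F"
    by (intro lborel.borel_measurable_lebesgue_integral) (simp add: split_beta')
  moreover have "(\<integral>s. indicator {0..t} s *\<^sub>R g (X (?clip s) \<omega>) \<partial>lborel) = (LBINT s:{0..t}. g (X s \<omega>))" for \<omega>
    unfolding set_lebesgue_integral_def
    by (intro Bochner_Integration.integral_cong) (auto simp: indicator_def min_def max_def)
  ultimately show ?thesis by (simp only:)
qed

context rhmc_test_process
begin

abbreviation filtration_Z :: "real \<Rightarrow> 'w measure" where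
  "filtration_Z \<equiv> natural_filtration M Z"

lemma natural_filtration_generators:
  "{Z s -` A \<inter> space M | s A. 0 \<le> s \<and> s \<le> t \<and> A \<in> sets borel} \<subseteq> Pow (space M)"
  by auto

lemma space_filtration_Z [simp]: "space (filtration_Z t) = space M"
  unfolding natural_filtration_def by (rule space_measure_of[OF natural_filtration_generators])

lemma sets_filtration_Z:
  "sets (filtration_Z t) = sigma_sets (space M) {Z s -` A \<inter> space M | s A. 0 \<le> s \<and> s \<le> t \<and> A \<in> sets borel}"
  unfolding natural_filtration_def by (rule sets_measure_of[OF natural_filtration_generators])

lemma filtration_Z_subalgebra: "subalgebra M (filtration_Z t)"
  unfolding subalgebra_def sets_filtration_Z
  by (auto intro!: sets.sigma_sets_subset measurable_sets[OF Z_measurable])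

lemma filtration_Z_mono:
  assumes "s \<le> t"
  shows "sets (filtration_Z s) \<subseteq> sets (filtration_Z t)"
  unfolding sets_filtration_Z
proof (rule sigma_sets_mono', rule subsetI)
  fix B assume "B \<in> {Z r -` A \<inter> space M | r A. 0 \<le> r \<and> r \<le> s \<and> A \<in> sets borel}"
  then obtain r A where "B = Z r -` A \<inter> space M" "0 \<le> r" "r \<le> s" "A \<in> sets borel"
    by (elim CollectE exE conjE)
  with assms show "B \<in> {Z r -` A \<inter> space M | r A. 0 \<le> r \<and> r \<le> t \<and> A \<in> sets borel}"
    by (intro CollectI exI[of _ r] exI[of _ A]) simp
qed

lemma Z_filtration_Z:
  assumes "0 \<le> s" "s \<le> t"
  shows "Z s \<in> borel_measurable (filtration_Z t)"
proof (rule measurableI)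
  fix A :: "'d phase set" assume A: "A \<in> sets borel"
  have "Z s -` A \<inter> space M \<in> {Z s -` A \<inter> space M | s A. 0 \<le> s \<and> s \<le> t \<and> A \<in> sets borel}"
    using A assms by (intro CollectI exI[of _ s] exI[of _ A]) simp
  then show "Z s -` A \<inter> space (filtration_Z t) \<in> sets (filtration_Z t)"
    unfolding space_filtration_Z sets_filtration_Z by (rule sigma_sets.Basic)
qed simp

lemma M_f_adapted:
  assumes "0 \<le> t"
  shows "M_f t \<in> borel_measurable (filtration_Z t)"
proof -
  have "(\<lambda>\<omega>. LBINT s:{0..t}. rhmc_generator lam \<phi> \<Phi> f (Z s \<omega>)) \<in> borel_measurable (filtration_Z t)"
    using assms
    by (intro cadlag_time_integral_measurable Z_filtration_Z rhmc_generator_measurable Z_cadlag) simp_all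
  moreover have "(\<lambda>\<omega>. f (Z t \<omega>)) \<in> borel_measurable (filtration_Z t)"
    using assms by (intro measurable_compose[OF Z_filtration_Z test_measurable]) simp_all
  ultimately show ?thesis unfolding M_f_def[abs_def] by measurable
qed

text \<open>The path as long as jump number \<open>n + 1\<close> has not occurred, written as a function of the first \<open>n\<close>
  noises only. The last segment is continued forever, whereas \<open>Z\<close> leaves it at \<open>T\<^bsub>n+1\<^esub>\<close>.\<close>

primrec path_before_jump :: "nat \<Rightarrow> real \<Rightarrow> 'w \<Rightarrow> 'd phase" where
  "path_before_jump 0 r \<omega> = \<theta> r z"
| "path_before_jump (Suc n) r \<omega> =
     (if T (Suc n) \<omega> \<le> r then \<theta> (r - T (Suc n) \<omega>) (S (Suc n) \<omega>) else path_before_jump n r \<omega>)"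

lemma path_before_jump_past: "path_before_jump n r \<in> borel_measurable (past n)"
proof (induction n)
  case 0
  have "path_before_jump 0 r = (\<lambda>_. \<theta> r z)" by (simp add: fun_eq_iff)
  then show ?case by simp
next
  case (Suc n)
  have [measurable]: "path_before_jump n r \<in> borel_measurable (past (Suc n))"
    by (rule measurable_past_mono[OF Suc.IH]) simp
  note [measurable] = S_past[of "Suc n"] T_past[of "Suc n"]
  have "path_before_jump (Suc n) r = (\<lambda>\<omega>. if T (Suc n) \<omega> \<le> r
      then \<theta> (r - T (Suc n) \<omega>) (S (Suc n) \<omega>) else path_before_jump n r \<omega>)"
    by (simp add: fun_eq_iff)
  then show ?case by (simp only:) measurable
qed

lemma Z_eq_path_before_jump:
  assumes reg: "regular \<omega>" and r: "0 \<le> r" "r < T (Suc n) \<omega>"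
  shows "Z r \<omega> = path_before_jump n r \<omega>"
  using r(2)
proof (induction n)
  case 0
  with reg r(1) have "Z r \<omega> = \<theta> (r - T 0 \<omega>) (S 0 \<omega>)"
    unfolding regular_def by (metis T_0)
  then show ?case by simp
next
  case (Suc n)
  show ?case
  proof (cases "T (Suc n) \<omega> \<le> r")
    case True
    with reg Suc.prems have "Z r \<omega> = \<theta> (r - T (Suc n) \<omega>) (S (Suc n) \<omega>)"
      unfolding regular_def by blast
    with True show ?thesis by simp
  next
    case False
    with Suc.IH show ?thesis by simp
  qed
qed

text \<open>As long as jump number \<open>n + 1\<close> has not occurred, observing \<open>Z\<close> up to \<open>s\<close> reveals nothing about the
  past beyond the first \<open>n\<close> noises. The events with this property form a \<open>\<sigma>\<close>-algebra that contains the
  generators of the natural filtration.\<close>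

lemma filtration_Z_trace_before_jump:
  assumes "A \<in> sets (filtration_Z s)"
  shows "\<exists>B\<in>sets (past n). \<forall>\<omega>\<in>space M. regular \<omega> \<and> s < T (Suc n) \<omega> \<longrightarrow> (\<omega> \<in> A \<longleftrightarrow> \<omega> \<in> B)"
  using assms unfolding sets_filtration_Z
proof (induction rule: sigma_sets.induct)
  case (Basic A)
  then obtain r E where A: "A = Z r -` E \<inter> space M" and r: "0 \<le> r" "r \<le> s" and E: "E \<in> sets borel"
    by (elim CollectE exE conjE)
  show ?case
  proof (rule bexI)
    show "path_before_jump n r -` E \<inter> space M \<in> sets (past n)"
      using measurable_sets[OF path_before_jump_past E] by simp
    show "\<forall>\<omega>\<in>space M. regular \<omega> \<and> s < T (Suc n) \<omega> \<longrightarrow> (\<omega> \<in> A \<longleftrightarrow> \<omega> \<in> path_before_jump n r -` E \<inter> space M)"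
    proof (intro ballI impI)
      fix \<omega> assume "\<omega> \<in> space M" "regular \<omega> \<and> s < T (Suc n) \<omega>"
      with r have "Z r \<omega> = path_before_jump n r \<omega>" by (intro Z_eq_path_before_jump) simp_all
      then show "\<omega> \<in> A \<longleftrightarrow> \<omega> \<in> path_before_jump n r -` E \<inter> space M" by (simp add: A)
    qed
  qed
next
  case Empty
  show ?case by (rule bexI[of _ "{}"]) simp_all
next
  case (Compl A)
  then obtain B where B: "B \<in> sets (past n)"
    "\<forall>\<omega>\<in>space M. regular \<omega> \<and> s < T (Suc n) \<omega> \<longrightarrow> (\<omega> \<in> A \<longleftrightarrow> \<omega> \<in> B)" by (elim bexE)
  have "space M - B \<in> sets (past n)" using sets.compl_sets[OF B(1)] by simp
  then show ?case using B(2) by (intro bexI[of _ "space M - B"]) auto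
next
  case (Union A)
  then have "\<forall>i. \<exists>B. B \<in> sets (past n) \<and>
      (\<forall>\<omega>\<in>space M. regular \<omega> \<and> s < T (Suc n) \<omega> \<longrightarrow> (\<omega> \<in> A i \<longleftrightarrow> \<omega> \<in> B))" by blast
  from choice[OF this] obtain B where B: "\<forall>i. B i \<in> sets (past n) \<and>
      (\<forall>\<omega>\<in>space M. regular \<omega> \<and> s < T (Suc n) \<omega> \<longrightarrow> (\<omega> \<in> A i \<longleftrightarrow> \<omega> \<in> B i))" ..
  then have "(\<Union>i. B i) \<in> sets (past n)" by auto
  then show ?case using B by (intro bexI[of _ "\<Union>i. B i"]) auto
qed

text \<open>If jump number \<open>n + 1\<close> has not occurred by time \<open>s\<close>, then \<open>A\<close> may be replaced by an event \<open>B\<close> of the past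
  noise; otherwise the \<open>n\<close>-th term no longer changes after \<open>s\<close>. So the increment has the same integral
  over \<open>A\<close> as over \<open>B\<close>, where it vanishes.\<close>

lemma jump_term_increment_orthogonal:
  assumes s: "0 \<le> s" "s \<le> t" and A: "A \<in> sets (filtration_Z s)"
  shows "expectation (\<lambda>\<omega>. indicator A \<omega> * jump_term t n \<omega>) = expectation (\<lambda>\<omega>. indicator A \<omega> * jump_term s n \<omega>)"
proof -
  have t: "0 \<le> t" using s by simp
  obtain B where B: "B \<in> sets (past n)"
    and trace: "\<forall>\<omega>\<in>space M. regular \<omega> \<and> s < T (Suc n) \<omega> \<longrightarrow> (\<omega> \<in> A \<longleftrightarrow> \<omega> \<in> B)"
    using filtration_Z_trace_before_jump[OF A, of n] by (elim bexE)
  have AM: "A \<in> sets M" using A filtration_Z_subalgebra by (auto simp: subalgebra_def)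
  have BM: "B \<in> sets M" using B past_subalgebra by (auto simp: subalgebra_def)
  have int: "integrable M (\<lambda>\<omega>. indicator E \<omega> * jump_term u n \<omega>)" if "E \<in> sets M" "0 \<le> u" for E u
    using integrable_real_mult_indicator[OF that(1) integrable_jump_term[OF that(2)]]
    by (simp add: mult.commute)
  let ?D = "\<lambda>E \<omega>. indicator E \<omega> * jump_term t n \<omega> - indicator E \<omega> * jump_term s n \<omega>"
  have D_int: "integrable M (?D E)" if "E \<in> sets M" for E
    by (intro Bochner_Integration.integrable_diff int that t s(1))
  have "AE \<omega> in M. ?D A \<omega> = ?D B \<omega>"
    using AE_regular AE_space
  proof eventually_elim
    case (elim \<omega>)
    show ?case
    proof (cases "s < T (Suc n) \<omega>")
      case True
      with trace elim have "\<omega> \<in> A \<longleftrightarrow> \<omega> \<in> B" by blast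
      then show ?thesis by (simp add: indicator_def)
    next
      case False
      then have "jump_term t n \<omega> = jump_term s n \<omega>"
        unfolding jump_term_def using s by (intro compensated_jump_stops) simp_all
      then show ?thesis by simp
    qed
  qed
  then have "expectation (?D A) = expectation (?D B)"
    by (intro integral_cong_AE borel_measurable_integrable D_int AM BM)
  moreover have "expectation (?D B) = 0"
    using jump_term_orthogonal_to_past[OF t B] jump_term_orthogonal_to_past[OF s(1) B]
      int[OF BM t] int[OF BM s(1)] by simp
  ultimately show ?thesis using int[OF AM t] int[OF AM s(1)] by simp
qed

lemma
  assumes t: "0 \<le> t"
  shows integrable_M_f: "integrable M (M_f t)"
    and expectation_indicator_M_f:
      "A \<in> sets M \<Longrightarrow> (\<lambda>n. expectation (\<lambda>\<omega>. indicator A \<omega> * jump_term t n \<omega>))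
         sums expectation (\<lambda>\<omega>. indicator A \<omega> * M_f t \<omega>)"
proof -
  note AE = AE_jump_terms_sum_to_M_f[OF t]
  have Mm: "M_f t \<in> borel_measurable M"
    by (rule measurable_from_subalg[OF filtration_Z_subalgebra M_f_adapted[OF t]])
  have "integrable M (\<lambda>\<omega>. \<Sum>n. jump_term t n \<omega>)"
  proof (rule integrable_suminf[OF integrable_jump_term[OF t]])
    show "AE \<omega> in M. summable (\<lambda>n. norm (jump_term t n \<omega>))" using AE by eventually_elim simp
    show "summable (\<lambda>n. expectation (\<lambda>\<omega>. norm (jump_term t n \<omega>)))"
      using summable_expectation_jump_term[OF t] by simp
  qed
  moreover have "AE \<omega> in M. (\<Sum>n. jump_term t n \<omega>) = M_f t \<omega>"
    using AE by eventually_elim (auto simp: sums_iff)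
  ultimately show "integrable M (M_f t)"
    by (subst integrable_cong_AE[of _ _ "\<lambda>\<omega>. \<Sum>n. jump_term t n \<omega>"]) (auto simp: Mm elim: AE_mp)
  assume A: "A \<in> sets M"
  have int: "integrable M (\<lambda>\<omega>. indicator A \<omega> * jump_term t n \<omega>)" for n
    using integrable_real_mult_indicator[OF A integrable_jump_term[OF t]] by (simp add: mult.commute)
  have sums: "AE \<omega> in M. (\<lambda>n. indicator A \<omega> * jump_term t n \<omega>) sums (indicator A \<omega> * M_f t \<omega>)"
    using AE by eventually_elim (auto intro: sums_mult)
  have "(\<lambda>n. expectation (\<lambda>\<omega>. indicator A \<omega> * jump_term t n \<omega>))
      sums expectation (\<lambda>\<omega>. \<Sum>n. indicator A \<omega> * jump_term t n \<omega>)"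
  proof (rule sums_integral[OF int])
    show "AE \<omega> in M. summable (\<lambda>n. norm (indicator A \<omega> * jump_term t n \<omega>))"
      using AE by eventually_elim (simp add: abs_mult summable_mult)
    show "summable (\<lambda>n. expectation (\<lambda>\<omega>. norm (indicator A \<omega> * jump_term t n \<omega>)))"
    proof (rule summable_comparison_test'[OF summable_expectation_jump_term[OF t]])
      fix n
      have "expectation (\<lambda>\<omega>. norm (indicator A \<omega> * jump_term t n \<omega>)) \<le> expectation (\<lambda>\<omega>. \<bar>jump_term t n \<omega>\<bar>)"
        by (intro integral_mono integrable_norm int integrable_abs integrable_jump_term t)
           (simp add: indicator_def)
      then show "norm (expectation (\<lambda>\<omega>. norm (indicator A \<omega> * jump_term t n \<omega>)))
          \<le> expectation (\<lambda>\<omega>. \<bar>jump_term t n \<omega>\<bar>)" by simp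
    qed
  qed
  also have "expectation (\<lambda>\<omega>. \<Sum>n. indicator A \<omega> * jump_term t n \<omega>) = expectation (\<lambda>\<omega>. indicator A \<omega> * M_f t \<omega>)"
  proof (rule integral_cong_AE)
    show "AE \<omega> in M. (\<Sum>n. indicator A \<omega> * jump_term t n \<omega>) = indicator A \<omega> * M_f t \<omega>"
      using sums by eventually_elim (auto simp: sums_iff)
  qed (use A Mm in measurable)
  finally show "(\<lambda>n. expectation (\<lambda>\<omega>. indicator A \<omega> * jump_term t n \<omega>))
      sums expectation (\<lambda>\<omega>. indicator A \<omega> * M_f t \<omega>)" .
qed

theorem martingale_M_f: "martingale M filtration_Z M_f"
  unfolding martingale_def
proof (intro conjI allI impI)
  show "filtration (space M) filtration_Z"
    by standard (simp_all add: filtration_Z_mono)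
  show "subalgebra M (filtration_Z t)" for t by (rule filtration_Z_subalgebra)
  show "M_f t \<in> borel_measurable (filtration_Z t)" "integrable M (M_f t)" if "0 \<le> t" for t
    using that by (fact M_f_adapted, fact integrable_M_f)
  fix s t :: real assume "0 \<le> s \<and> s \<le> t"
  then have s: "0 \<le> s" "s \<le> t" and t: "0 \<le> t" by auto
  interpret finite_measure_subalgebra M "filtration_Z s"
    by unfold_locales (rule filtration_Z_subalgebra)
  show "AE \<omega> in M. real_cond_exp M (filtration_Z s) (M_f t) \<omega> = M_f s \<omega>"
  proof (rule real_cond_exp_charact)
    fix A assume A: "A \<in> sets (filtration_Z s)"
    then have AM: "A \<in> sets M" using filtration_Z_subalgebra by (auto simp: subalgebra_def)
    have "expectation (\<lambda>\<omega>. indicator A \<omega> * M_f t \<omega>) = expectation (\<lambda>\<omega>. indicator A \<omega> * M_f s \<omega>)"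
      using expectation_indicator_M_f[OF t AM] expectation_indicator_M_f[OF s(1) AM]
      unfolding jump_term_increment_orthogonal[OF s A] by (rule sums_unique2)
    then show "(\<integral>\<omega>\<in>A. M_f t \<omega> \<partial>M) = (\<integral>\<omega>\<in>A. M_f s \<omega> \<partial>M)"
      unfolding set_lebesgue_integral_def by simp
  qed (intro integrable_M_f t s(1) M_f_adapted)+
qed

end

theorem lemma3p5:
  fixes \<Phi> :: "real ^ 'd::finite \<Rightarrow> real"
    and lam \<phi> c1 c2 :: real
    and \<theta> :: "real \<Rightarrow> 'd phase \<Rightarrow> 'd phase"
    and M :: "'w measure"
    and z :: "'d phase"
    and \<delta> :: "nat \<Rightarrow> 'w \<Rightarrow> real"
    and \<xi> :: "nat \<Rightarrow> 'w \<Rightarrow> real ^ 'd"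
    and Z :: "real \<Rightarrow> 'w \<Rightarrow> 'd phase"
    and f :: "'d phase \<Rightarrow> real"
  assumes lam: "lam > 0"
    and phi: "0 < \<phi>" "\<phi> \<le> pi / 2"
    and c1: "c1 = (1 / lam) / 4 * (sin \<phi>)\<^sup>2"
    and c2: "c2 = 1 / lam * c1 * (1 - cos \<phi>)"
    and Phi_C2: "C2 \<Phi>"
    and H1: "\<forall>q. \<Phi> q \<ge> 0" "integrable lborel (\<lambda>q. (norm q)\<^sup>2 * exp (- \<Phi> q))"
    and H2: "\<exists>a b. a > 0 \<and> 0 < b \<and> b < 1 \<and>
      (\<forall>q. 1 / 2 * (grad \<Phi> q \<bullet> q) \<ge>
         b * \<Phi> q + ((c1 * b)\<^sup>2 + c2 * b * (1 - b)) / (2 * (1 - b)) * (norm q)\<^sup>2 - a)"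
    and flow: "hamiltonian_flow \<Phi> \<theta>"
    and Z: "rhmc_process M lam \<phi> \<theta> z \<delta> \<xi> Z"
    and f_lipschitz: "\<exists>C. C-lipschitz_on UNIV f"
    and f_C1: "C1 f"
  shows "martingale M (natural_filtration M Z)
    (\<lambda>t \<omega>. f (Z t \<omega>) - f z
       - (LBINT s:{0..t}. rhmc_generator lam \<phi> \<Phi> f (Z s \<omega>)))"
proof -
  from f_lipschitz obtain C where C: "C-lipschitz_on UNIV f" ..
  interpret rhmc_process M lam \<phi> \<theta> z \<delta> \<xi> Z by (rule Z)
  interpret rhmc_test_process \<Phi> \<theta> lam \<phi> f C M z \<delta> \<xi> Z
    by unfold_locales (use Phi_C2 H1(1) flow lam C f_C1 in simp_all)
  show ?thesis using martingale_M_f unfolding M_f_def[abs_def] .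
qed

end
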